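(* Let $(f_n)_{n=1}^{\infty}$ be a sequence of real polynomials, and write $d_n=\deg(f_n)$. Suppose: (1) the sequence $(d_n)_{n=1}^{\infty}$ is strictly increasing; (2) for any $n_2>n_1$ the function $f_{n_2}-f_{n_1}:(1,\infty)\to\mathbb{R}$ is strictly increasing and convex; (3) for any $[a,b]\subset(1,\infty)$ there exists $c_{a,b}>0$ such that for all $\alpha\in[a,b]$ and all $n_2>n_1$ we have $(f_{n_2}-f_{n_1})'(\alpha)\geq c_{a,b}\, d_{n_2}\,\alpha^{d_{n_2}}$; (4) for any $[a,b]\subset(1,\infty)$ there exists $C_{a,b}>1$ such that for all $\alpha\in[a,b]$ and all $n_2>n_1$ we have $\frac{\alpha^{d_{n_2}}}{C_{a,b}}\leq (f_{n_2}-f_{n_1})(\alpha)\leq C_{a,b}\,\alpha^{d_{n_2}}$; (5) for any $[a,b]\subset(1,\infty)$ and $C_{a,b}$ as in (4), for all sufficiently large $n_1$ the following inequality holds for all $n_2>n_1$: $$\left(\frac{2d_{n_2}}{d_{n_1}}-1\right)\log C_{a,b}+(d_{n_1}-d_{n_2})\log a-\log\left(d_{n_2}\left(\frac{d_{n_2}}{d_{n_1}}-1\right)\right)\leq -3\log n_2.$$ Then for Lebesgue almost every $\alpha>1$ the sequence $(f_n(\alpha))_{n=1}^{\infty}$ has Poissonian pair correlations.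
   Context: For $x\in\mathbb{R}$, $\|x\|$ denotes the distance from $x$ to the nearest integer. A real sequence $(x_n)_{n=1}^{\infty}$ has Poissonian pair correlations if for every $s>0$, $$\lim_{N\to\infty}\frac{\#\{(m,n):1\leq m,n\leq N,\ m\neq n,\ \|x_n-x_m\|\leq \frac{s}{N}\}}{N}=2s.$$ *)

theory Defs
  imports "HOL-Analysis.Analysis" "HOL-Computational_Algebra.Polynomial"
begin

definition dist_nearest_int :: "real \<Rightarrow> real" where
  "dist_nearest_int x = \<bar>x - of_int (round x)\<bar>"

text \<open>Sequences are indexed from \<open>1\<close>; the value \<open>x 0\<close> is irrelevant.\<close>

definition poissonian_pair_correlations :: "(nat \<Rightarrow> real) \<Rightarrow> bool" where
  "poissonian_pair_correlations x \<longleftrightarrow>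
     (\<forall>s>0. (\<lambda>N. real (card {(m, n) \<in> {1..N} \<times> {1..N}.
                   m \<noteq> n \<and> dist_nearest_int (x n - x m) \<le> s / real N}) / real N)
             \<longlonglongrightarrow> 2 * s)"

end

theory Submission imports Defs begin

text \<open>
  This is a second moment argument on a fixed interval \<open>[a, b]\<close>. For \<open>m < n\<close> let \<open>X\<close> be the indicator
  of \<open>f n - f m\<close> being within \<open>\<epsilon> = s / N\<close> of an integer, minus \<open>2 * \<epsilon>\<close>. If \<open>g\<close> is increasing and
  convex, the integral of its centred indicator over any interval \<open>[p, q]\<close> is at most
  \<open>2 * \<epsilon> / g' p\<close>. The growth condition gives \<open>a ^ (d n - d m) \<ge> c * n\<^sup>2\<close>, so a difference with
  larger top index \<open>n\<close> oscillates much faster than any difference with smaller top index, and the two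
  are uncorrelated up to \<open>O(\<epsilon> / n\<^sup>2)\<close>. For two pairs with the same top index an upper bound
  \<open>O(\<epsilon>\<^sup>2 + \<epsilon> / n\<^sup>2)\<close> suffices. Hence the pair correlation function has variance \<open>O(1 / N)\<close>; it
  converges almost everywhere along \<open>N = k\<^sup>2\<close>, and monotonicity of the pair count in \<open>N\<close> and \<open>\<epsilon>\<close>
  fills the gaps.
\<close>

subsection \<open>Distribution of a convex function modulo 1\<close>

definition near_int :: "real \<Rightarrow> real \<Rightarrow> real" where
  "near_int \<epsilon> y = of_bool (dist_nearest_int y \<le> \<epsilon>)"

lemma near_int_range: "0 \<le> near_int \<epsilon> y" "near_int \<epsilon> y \<le> 1"
  by (auto simp: near_int_def)

lemma dist_nearest_int_le: "dist_nearest_int y \<le> \<bar>y - of_int j\<bar>"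
  unfolding dist_nearest_int_def by (rule round_diff_minimal)

lemma dist_nearest_int_minus: "dist_nearest_int (- y) = dist_nearest_int y"
proof -
  have "dist_nearest_int (- y) \<le> dist_nearest_int y" for y
    using dist_nearest_int_le[of "- y" "- round y"] by (simp add: dist_nearest_int_def)
  from this[of y] this[of "- y"] show ?thesis by simp
qed

lemma dist_nearest_int_diff_le:
  "dist_nearest_int (x - y) \<le> dist_nearest_int x + dist_nearest_int y"
  using dist_nearest_int_le[of "x - y" "round x - round y"]
  by (simp add: dist_nearest_int_def)

lemma borel_measurable_near_int [measurable]:
  "near_int \<epsilon> \<in> borel_measurable borel"
proof -
  have "(\<lambda>y::real. of_int (round y) :: real) \<in> borel_measurable borel"
    unfolding round_def by measurable
  then show ?thesis
    unfolding near_int_def dist_nearest_int_def by measurable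
qed

text \<open>An integer within \<epsilon> of y and an integer closer than 1 - \<epsilon> are less
  than 1 apart, hence equal. So the indicator can be read off from one fixed integer even where
  \<open>round\<close> jumps.\<close>

lemma near_int_eq:
  assumes "\<bar>y - of_int n\<bar> < 1 - \<epsilon>"
  shows "near_int \<epsilon> y = of_bool (\<bar>y - of_int n\<bar> \<le> \<epsilon>)"
proof -
  have "round y = n" if "\<bar>y - of_int (round y)\<bar> \<le> \<epsilon>"
  proof -
    have "\<bar>of_int (round y) - of_int n :: real\<bar> < 1" using that assms by linarith
    then show ?thesis by linarith
  qed
  then show ?thesis
    using dist_nearest_int_le[of y n] unfolding near_int_def dist_nearest_int_def by fastforce
qed

text \<open>The bounded periodic primitive of \<open>near_int \<epsilon> - 2 * \<epsilon>\<close>.\<close>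

definition near_int_prim :: "real \<Rightarrow> real \<Rightarrow> real" where
  "near_int_prim \<epsilon> y =
     max (- \<epsilon>) (min \<epsilon> (y - of_int (round y))) - 2 * \<epsilon> * (y - of_int (round y))"

text \<open>For a remainder r with |r| \<le> \<epsilon> the value is (1 - 2 * \<epsilon>) * r.
  Beyond that it is the difference of \<epsilon> and 2 * \<epsilon> * |r|, up to sign; both numbers
  lie between 0 and \<epsilon>.\<close>

lemma near_int_prim_bound:
  assumes "0 < \<epsilon>" "\<epsilon> < 1/2"
  shows "\<bar>near_int_prim \<epsilon> y\<bar> \<le> \<epsilon>"
proof -
  define r where "r = y - of_int (round y)"
  have r: "\<bar>r\<bar> \<le> 1/2" unfolding r_def using of_int_round_abs_le[of y] by linarith
  have "\<bar>\<epsilon> * r\<bar> \<le> \<epsilon> * (1/2)" using r assms by (simp add: abs_mult)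
  then have 1: "\<bar>2 * \<epsilon> * r\<bar> \<le> \<epsilon>" by simp
  have "\<bar>(1 - 2 * \<epsilon>) * r\<bar> \<le> 1 * \<bar>r\<bar>"
    unfolding abs_mult using assms by (intro mult_right_mono) auto
  then have 2: "\<bar>r - 2 * \<epsilon> * r\<bar> \<le> \<bar>r\<bar>" by (simp add: algebra_simps)
  have "0 \<le> \<epsilon> * r \<longleftrightarrow> 0 \<le> r" using assms by (simp add: zero_le_mult_iff)
  then show ?thesis
    using 1 2 assms unfolding near_int_prim_def r_def[symmetric] by (auto simp: max_def min_def abs_if split: if_splits)
qed

text \<open>If rounding moves to a neighbour of n, the clamped term jumps by 2 * \<epsilon>, and the
  linear term compensates exactly. The right-hand side is continuous in y for fixed n, so continuity
  and derivatives can be taken from it.\<close>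

lemma near_int_prim_eq:
  assumes "0 < \<epsilon>" "\<epsilon> < 1/2" "\<bar>y - of_int n\<bar> < 1 - \<epsilon>"
  shows "near_int_prim \<epsilon> y = max (- \<epsilon>) (min \<epsilon> (y - of_int n)) - 2 * \<epsilon> * (y - of_int n)"
proof -
  have r: "\<bar>of_int (round y) - y\<bar> \<le> 1/2" by (rule of_int_round_abs_le)
  then have "\<bar>of_int (round y) - of_int n :: real\<bar> < 3/2" using assms by linarith
  then have "round y = n \<or> round y = n + 1 \<or> round y = n - 1" by linarith
  then consider "round y = n" | "of_int (round y) = (of_int n + 1 :: real)" | "of_int (round y) = (of_int n - 1 :: real)"
    by auto
  then show ?thesis
  proof cases
    case 2
    then have "y - of_int (round y) \<le> -\<epsilon>" "y - of_int n \<ge> \<epsilon>" using r assms by linarith+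
    then show ?thesis unfolding near_int_prim_def using assms 2 
      by (simp add: max_absorb1 min_absorb1 min_absorb2 max_absorb2 algebra_simps)
  next
    case 3
    then have n: "of_int n = (of_int (round y) + 1 :: real)" by simp
    have "y - of_int (round y) \<ge> \<epsilon>" "y - of_int n \<le> -\<epsilon>" using r assms n by linarith+
    then show ?thesis unfolding near_int_prim_def using assms
      by (simp add: n max_absorb1 min_absorb1 min_absorb2 max_absorb2 algebra_simps)
  qed (simp add: near_int_prim_def)
qed

text \<open>Since 1/2 < 1 - \<epsilon>, the window of validity of the fixed-integer formulas is a
  neighbourhood of y, also when y is a half-integer.\<close>

lemma eventually_near_round:
  fixes y :: real
  assumes "\<epsilon> < 1/2"
  shows "\<forall>\<^sub>F z in nhds y. \<bar>z - of_int (round y)\<bar> < 1 - \<epsilon>"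
proof -
  have "open {z::real. \<bar>z - of_int (round y)\<bar> < 1 - \<epsilon>}"
    by (intro open_Collect_less continuous_intros)
  moreover have "\<bar>y - of_int (round y)\<bar> < 1 - \<epsilon>"
    using of_int_round_abs_le[of y] assms by linarith
  ultimately show ?thesis
    unfolding eventually_nhds by (intro exI[of _ "{z. \<bar>z - of_int (round y)\<bar> < 1 - \<epsilon>}"]) auto
qed

lemma isCont_near_int_prim:
  assumes "0 < \<epsilon>" "\<epsilon> < 1/2"
  shows "isCont (near_int_prim \<epsilon>) y"
proof -
  let ?n = "of_int (round y) :: real"
  have "\<forall>\<^sub>F z in nhds y. near_int_prim \<epsilon> z = max (- \<epsilon>) (min \<epsilon> (z - ?n)) - 2 * \<epsilon> * (z - ?n)"
    using eventually_near_round[OF assms(2)] by eventually_elim (use assms near_int_prim_eq in blast)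
  moreover have "isCont (\<lambda>z. max (- \<epsilon>) (min \<epsilon> (z - ?n)) - 2 * \<epsilon> * (z - ?n)) y"
    by (intro continuous_intros)
  ultimately show ?thesis by (subst isCont_cong)
qed

text \<open>Off the kinks the local formula is affine: its slope is 1 - 2 * \<epsilon> inside the
  \<epsilon>-window of the nearest integer and - 2 * \<epsilon> outside.\<close>

lemma DERIV_near_int_prim:
  assumes "0 < \<epsilon>" "\<epsilon> < 1/2" and ne: "\<And>j::int. \<bar>y - of_int j\<bar> \<noteq> \<epsilon>"
  shows "(near_int_prim \<epsilon> has_real_derivative near_int \<epsilon> y - 2 * \<epsilon>) (at y)"
proof -
  let ?n = "of_int (round y) :: real"
  have ev: "\<forall>\<^sub>F z in nhds y. near_int_prim \<epsilon> z = max (- \<epsilon>) (min \<epsilon> (z - ?n)) - 2 * \<epsilon> * (z - ?n)"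
    using eventually_near_round[OF assms(2)] by eventually_elim (use assms near_int_prim_eq in blast)
  have nearby: "\<bar>y - ?n\<bar> < 1 - \<epsilon>"
    using of_int_round_abs_le[of y] assms by linarith
  consider "\<bar>y - ?n\<bar> < \<epsilon>" | "y - ?n > \<epsilon>" | "y - ?n < - \<epsilon>"
    using ne[of "round y"] by linarith
  then show ?thesis
  proof cases
    case 1
    have o: "open {z. \<bar>z - ?n\<bar> < \<epsilon>}" by (intro open_Collect_less continuous_intros)
    have "\<forall>\<^sub>F z in nhds y. \<bar>z - ?n\<bar> < \<epsilon>"
      using eventually_nhds_in_open[OF o] 1 by simp
    with ev have ev': "\<forall>\<^sub>F z in nhds y. near_int_prim \<epsilon> z = (z - ?n) - 2 * \<epsilon> * (z - ?n)"
      by eventually_elim (auto simp: max_def min_def)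
    have "((\<lambda>z. (z - ?n) - 2 * \<epsilon> * (z - ?n)) has_real_derivative 1 - 2 * \<epsilon>) (at y)"
      by (auto intro!: derivative_eq_intros)
    moreover have "near_int \<epsilon> y = 1" using near_int_eq[OF nearby] 1 by simp
    ultimately show ?thesis using DERIV_cong_ev[OF refl ev' refl] by simp
  next
    case 2
    have o: "open {z. z - ?n > \<epsilon>}" by (intro open_Collect_less continuous_intros)
    have "\<forall>\<^sub>F z in nhds y. z - ?n > \<epsilon>"
      using eventually_nhds_in_open[OF o] 2 by simp
    with ev have ev': "\<forall>\<^sub>F z in nhds y. near_int_prim \<epsilon> z = \<epsilon> - 2 * \<epsilon> * (z - ?n)"
      by eventually_elim (use assms in \<open>auto simp: max_def min_def\<close>)
    have "((\<lambda>z. \<epsilon> - 2 * \<epsilon> * (z - ?n)) has_real_derivative 0 - 2 * \<epsilon>) (at y)"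
      by (auto intro!: derivative_eq_intros)
    moreover have "near_int \<epsilon> y = 0" using near_int_eq[OF nearby] 2 by simp
    ultimately show ?thesis using DERIV_cong_ev[OF refl ev' refl] by simp
  next
    case 3
    have o: "open {z. z - ?n < - \<epsilon>}" by (intro open_Collect_less continuous_intros)
    have "\<forall>\<^sub>F z in nhds y. z - ?n < - \<epsilon>"
      using eventually_nhds_in_open[OF o] 3 by simp
    with ev have ev': "\<forall>\<^sub>F z in nhds y. near_int_prim \<epsilon> z = - \<epsilon> - 2 * \<epsilon> * (z - ?n)"
      by eventually_elim (use assms in \<open>auto simp: max_def min_def\<close>)
    have "((\<lambda>z. - \<epsilon> - 2 * \<epsilon> * (z - ?n)) has_real_derivative 0 - 2 * \<epsilon>) (at y)"
      by (auto intro!: derivative_eq_intros)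
    moreover have "near_int \<epsilon> y = 0" using near_int_eq[OF nearby] 3 assms by simp
    ultimately show ?thesis using DERIV_cong_ev[OF refl ev' refl] by simp
  qed
qed

text \<open>Integrate the derivative of \<open>near_int_prim \<epsilon> (g x) / g' x\<close>; since \<open>1 / g'\<close> is decreasing, the
  error term is dominated by a telescoping integral.\<close>

lemma integral_near_int_bound:
  fixes g g' g'' :: "real \<Rightarrow> real"
  assumes \<epsilon>: "0 < \<epsilon>" "\<epsilon> < 1/2" and pq: "p \<le> q"
    and g: "\<And>x. x \<in> {p..q} \<Longrightarrow> (g has_real_derivative g' x) (at x)"
    and g': "\<And>x. x \<in> {p..q} \<Longrightarrow> (g' has_real_derivative g'' x) (at x)"
    and g'': "continuous_on {p..q} g''"
    and pos: "\<And>x. x \<in> {p..q} \<Longrightarrow> 0 < g' x"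
    and cvx: "\<And>x. x \<in> {p..q} \<Longrightarrow> 0 \<le> g'' x"
  shows "(\<lambda>x. near_int \<epsilon> (g x) - 2 * \<epsilon>) integrable_on {p..q}"
    and "\<bar>integral {p..q} (\<lambda>x. near_int \<epsilon> (g x) - 2 * \<epsilon>)\<bar> \<le> 2 * \<epsilon> / g' p"
proof -
  have contg: "continuous_on {p..q} g" using g by (meson DERIV_isCont continuous_at_imp_continuous_on)
  have contg': "continuous_on {p..q} g'" using g' by (meson DERIV_isCont continuous_at_imp_continuous_on)
  have ne: "g' x \<noteq> 0" if "x \<in> {p..q}" for x using pos[OF that] by simp
  have inj: "inj_on g {p..q}"
  proof (rule linorder_inj_onI)
    fix x y assume xy: "x < y" "x \<in> {p..q}" "y \<in> {p..q}"
    have "g x < g y"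
      by (rule DERIV_pos_imp_increasing[OF xy(1)]) (use xy g pos in \<open>meson atLeastAtMost_iff order_trans\<close>)
    then show "g x \<noteq> g y" by simp
  qed auto
  \<comment> \<open>The kinks of \<open>near_int_prim \<epsilon> (g x)\<close>, which are the
    exceptional points for the fundamental theorem of calculus. They are finitely many because g is
    injective and its bounded image contains finitely many numbers of the form j + \<epsilon> or j -
    \<epsilon>.\<close>
  define S where "S = {x \<in> {p..q}. \<exists>j::int. \<bar>g x - of_int j\<bar> = \<epsilon>}"
  have finS: "finite S"
  proof -
    have "bounded (g ` {p..q})" using contg compact_continuous_image compact_imp_bounded by blast
    then obtain B where B: "\<And>x. x \<in> {p..q} \<Longrightarrow> \<bar>g x\<bar> \<le> B"
      unfolding bounded_iff by (metis imageI real_norm_def)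
    have "g ` S \<subseteq> (\<lambda>j. of_int j + \<epsilon>) ` {-\<lceil>B + 1\<rceil>..\<lceil>B + 1\<rceil>} \<union> (\<lambda>j. of_int j - \<epsilon>) ` {-\<lceil>B + 1\<rceil>..\<lceil>B + 1\<rceil>}"
    proof (rule image_subsetI)
      fix x assume "x \<in> S"
      then obtain j :: int where x: "x \<in> {p..q}" and j: "\<bar>g x - of_int j\<bar> = \<epsilon>" unfolding S_def by auto
      have "\<bar>of_int j :: real\<bar> \<le> B + 1" using B[OF x] j \<epsilon> by linarith
      then have "j \<in> {-\<lceil>B + 1\<rceil>..\<lceil>B + 1\<rceil>}" by simp linarith
      moreover have "g x = of_int j + \<epsilon> \<or> g x = of_int j - \<epsilon>" using j by linarith
      ultimately show "g x \<in> (\<lambda>j. of_int j + \<epsilon>) ` {-\<lceil>B + 1\<rceil>..\<lceil>B + 1\<rceil>} \<union> (\<lambda>j. of_int j - \<epsilon>) ` {-\<lceil>B + 1\<rceil>..\<lceil>B + 1\<rceil>}"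
        by blast
    qed
    then have "finite (g ` S)" by (rule finite_subset) simp
    moreover have "inj_on g S" using inj by (rule inj_on_subset) (auto simp: S_def)
    ultimately show ?thesis by (rule finite_imageD)
  qed
  define P where "P = (\<lambda>x. near_int_prim \<epsilon> (g x))"
  have contP: "continuous_on {p..q} P"
    unfolding P_def
    using continuous_on_compose2[OF _ contg, of UNIV "near_int_prim \<epsilon>"] isCont_near_int_prim[OF \<epsilon>]
    by (simp add: continuous_at_imp_continuous_on)
  have Pb: "\<bar>P x\<bar> \<le> \<epsilon>" for x unfolding P_def by (rule near_int_prim_bound[OF \<epsilon>])
  have I1: "((\<lambda>x. near_int \<epsilon> (g x) - 2 * \<epsilon> - P x * (g'' x / (g' x)\<^sup>2)) has_integral
      (P q / g' q - P p / g' p)) {p..q}"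
  proof (rule fundamental_theorem_of_calculus_strong[OF finS pq])
    fix x assume x: "x \<in> {p..q} - S"
    then have xi: "x \<in> {p..q}" by simp
    have "(near_int_prim \<epsilon> has_real_derivative near_int \<epsilon> (g x) - 2 * \<epsilon>) (at (g x))"
      using x by (intro DERIV_near_int_prim \<epsilon>) (auto simp: S_def)
    then have "(P has_real_derivative (near_int \<epsilon> (g x) - 2 * \<epsilon>) * g' x) (at x)"
      unfolding P_def using g[OF xi] by (rule DERIV_chain2)
    from DERIV_divide[OF this g'[OF xi] ne[OF xi]]
    have "((\<lambda>x. P x / g' x) has_real_derivative
       ((near_int \<epsilon> (g x) - 2 * \<epsilon>) * g' x * g' x - P x * g'' x) / (g' x * g' x)) (at x)" .
    moreover have "((near_int \<epsilon> (g x) - 2 * \<epsilon>) * g' x * g' x - P x * g'' x) / (g' x * g' x)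
       = near_int \<epsilon> (g x) - 2 * \<epsilon> - P x * (g'' x / (g' x)\<^sup>2)"
      using ne[OF xi] by (simp add: field_simps power2_eq_square)
    ultimately show "((\<lambda>x. P x / g' x) has_vector_derivative
       near_int \<epsilon> (g x) - 2 * \<epsilon> - P x * (g'' x / (g' x)\<^sup>2)) (at x)"
      by (simp add: has_real_derivative_iff_has_vector_derivative)
  next
    show "continuous_on {p..q} (\<lambda>x. P x / g' x)"
      using contP contg' ne by (intro continuous_intros) auto
  qed
  have int2: "(\<lambda>x. P x * (g'' x / (g' x)\<^sup>2)) integrable_on {p..q}"
    using contP contg' g'' ne by (intro integrable_continuous_interval continuous_intros) auto
  have I3: "((\<lambda>x. \<epsilon> * (g'' x / (g' x)\<^sup>2)) has_integral (- \<epsilon> / g' q - (- \<epsilon> / g' p))) {p..q}"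
  proof (rule fundamental_theorem_of_calculus[OF pq])
    fix x assume xi: "x \<in> {p..q}"
    have "((\<lambda>x. - \<epsilon> / g' x) has_real_derivative \<epsilon> * (g'' x / (g' x)\<^sup>2)) (at x)"
      using g'[OF xi] ne[OF xi] by (auto intro!: derivative_eq_intros simp: power2_eq_square)
    then show "((\<lambda>x. - \<epsilon> / g' x) has_vector_derivative \<epsilon> * (g'' x / (g' x)\<^sup>2)) (at x within {p..q})"
      by (simp add: has_real_derivative_iff_has_vector_derivative has_vector_derivative_at_within)
  qed
  have "norm (integral {p..q} (\<lambda>x. P x * (g'' x / (g' x)\<^sup>2))) \<le> integral {p..q} (\<lambda>x. \<epsilon> * (g'' x / (g' x)\<^sup>2))"
  proof (rule integral_norm_bound_integral[OF int2])
    show "(\<lambda>x. \<epsilon> * (g'' x / (g' x)\<^sup>2)) integrable_on {p..q}" using I3 by blast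
    fix x assume "x \<in> {p..q}"
    then show "norm (P x * (g'' x / (g' x)\<^sup>2)) \<le> \<epsilon> * (g'' x / (g' x)\<^sup>2)"
      unfolding real_norm_def abs_mult using cvx Pb \<epsilon> by (intro mult_mono) auto
  qed
  then have b2: "\<bar>integral {p..q} (\<lambda>x. P x * (g'' x / (g' x)\<^sup>2))\<bar> \<le> \<epsilon> / g' p - \<epsilon> / g' q"
    using integral_unique[OF I3] by simp
  have hi: "((\<lambda>x. near_int \<epsilon> (g x) - 2 * \<epsilon>) has_integral
      (P q / g' q - P p / g' p) + integral {p..q} (\<lambda>x. P x * (g'' x / (g' x)\<^sup>2))) {p..q}"
    using has_integral_add[OF I1 integrable_integral[OF int2]] by simp
  then show "(\<lambda>x. near_int \<epsilon> (g x) - 2 * \<epsilon>) integrable_on {p..q}" by blast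
  from hi have eq: "integral {p..q} (\<lambda>x. near_int \<epsilon> (g x) - 2 * \<epsilon>) =
      P q / g' q - P p / g' p + integral {p..q} (\<lambda>x. P x * (g'' x / (g' x)\<^sup>2))"
    by (rule integral_unique)
  have pb: "\<bar>P x / g' x\<bar> \<le> \<epsilon> / g' x" if "x \<in> {p..q}" for x
    using pos[OF that] Pb[of x] by (simp add: divide_right_mono)
  \<comment> \<open>The boundary term at q is absorbed by the - \<epsilon> / g' q in
    \<open>b2\<close>; what remains is the contribution of p, counted twice.\<close>
  have "\<bar>P q / g' q\<bar> \<le> \<epsilon> / g' q" "\<bar>P p / g' p\<bar> \<le> \<epsilon> / g' p" using pb pq by auto
  with b2 eq have "\<bar>integral {p..q} (\<lambda>x. near_int \<epsilon> (g x) - 2 * \<epsilon>)\<bar> \<le> \<epsilon> / g' p + \<epsilon> / g' p" by linarith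
  then show "\<bar>integral {p..q} (\<lambda>x. near_int \<epsilon> (g x) - 2 * \<epsilon>)\<bar> \<le> 2 * \<epsilon> / g' p" by simp
qed

section \<open>Correlation of a fast convex function with a slow monotone one\<close>

text \<open>The sequence \<open>harm n - ln n\<close> decreases from its value 1 at n = 1.\<close>

lemma harm_le_ln:
  assumes "n > 0"
  shows "harm n \<le> 1 + ln (real n)"
  using euler_mascheroni_sequence_decreasing[of 1 n] assms by (simp add: harm_def)

text \<open>The second factor is the indicator of disjoint intervals around the preimages of the integers
  \<open>j\<close> under \<open>h\<close>; on the \<open>j\<close>-th one \<open>g'\<close> is at least about \<open>L * j\<close>, whence a harmonic sum.\<close>

lemma integral_near_int_correlation:
  fixes g g' g'' h :: "real \<Rightarrow> real"
  assumes \<epsilon>: "0 < \<epsilon>" "\<epsilon> < 1/2" and \<delta>: "0 < \<delta>" "\<delta> < 1/2"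
    and g: "\<And>x. x \<in> {a..b} \<Longrightarrow> (g has_real_derivative g' x) (at x)"
    and g': "\<And>x. x \<in> {a..b} \<Longrightarrow> (g' has_real_derivative g'' x) (at x)"
    and g'': "continuous_on {a..b} g''"
    and cvx: "\<And>x. x \<in> {a..b} \<Longrightarrow> 0 \<le> g'' x"
    and h: "continuous_on {a..b} h" "mono_on {a..b} h"
    and h_range: "\<And>x. x \<in> {a..b} \<Longrightarrow> 0 \<le> h x \<and> h x \<le> H"
    and L: "L > 0" and "H \<ge> 0"
    and g'_ge: "\<And>x. x \<in> {a..b} \<Longrightarrow> L * max 1 (h x) \<le> g' x"
  shows "\<bar>integral {a..b} (\<lambda>x. (near_int \<epsilon> (g x) - 2 * \<epsilon>) * near_int \<delta> (h x))\<bar>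
           \<le> 2 * \<epsilon> / L * (3 + 2 * ln (H + 1))"
proof -
  define X where "X = (\<lambda>x. near_int \<epsilon> (g x) - 2 * \<epsilon>)"
  define I where "I = (\<lambda>j::nat. {x \<in> {a..b}. \<bar>h x - real j\<bar> \<le> \<delta>})"
  define J where "J = nat \<lceil>H\<rceil>"
  \<comment> \<open>A bound on \<open>I j\<close> for the inverse of max 1 (h x): for j \<ge> 1
    there h \<ge> j - \<delta> \<ge> j / 2, while for j = 0 the constant 1 in the maximum takes
    over.\<close>
  define w where "w = (\<lambda>j::nat. if j = 0 then 1 else 2 / real j)"
  have pos: "0 < g' x" if "x \<in> {a..b}" for x
  proof -
    have "0 < L * max 1 (h x)" using L by (intro mult_pos_pos) auto
    then show ?thesis using g'_ge[OF that] by linarith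
  qed
  \<comment> \<open>As \<delta> < 1/2, only the integer nearest to h x can be within \<delta> of it;
    the range of h places that integer between 0 and J.\<close>
  have split: "near_int \<delta> (h x) = (\<Sum>j\<le>J. of_bool (x \<in> I j))" if x: "x \<in> {a..b}" for x
  proof -
    define k where "k = nat (round (h x))"
    have "0 \<le> round (h x)" using h_range[OF x] round_mono[of 0 "h x"] by simp
    then have k: "of_int (round (h x)) = real k" unfolding k_def by simp
    have "round (h x) \<le> \<lceil>H\<rceil>" using h_range[OF x] round_mono[of "h x" "of_int \<lceil>H\<rceil>"] by (simp add: order_trans[OF _ le_of_int_ceiling])
    then have kJ: "k \<in> {..J}" unfolding k_def J_def by (simp add: nat_mono)
    have kx: "\<bar>h x - real k\<bar> \<le> 1/2" using of_int_round_abs_le[of "h x"] k by linarith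
    have "of_bool (x \<in> I j) = (if j = k then near_int \<delta> (h x) else 0)" for j
    proof (cases "j = k")
      case True
      then show ?thesis using x k by (simp add: I_def near_int_def dist_nearest_int_def)
    next
      case False
      then have "\<bar>real j - real k\<bar> \<ge> 1" by linarith
      then have "\<bar>h x - real j\<bar> > \<delta>" using kx \<delta> by linarith
      then show ?thesis using False by (simp add: I_def)
    qed
    then show ?thesis using kJ by simp
  qed
  have piece: "X integrable_on (I j) \<and> \<bar>integral (I j) X\<bar> \<le> 2 * \<epsilon> / L * w j" for j
  proof (cases "I j = {}")
    case True
    then show ?thesis using \<epsilon> L by (simp add: w_def integrable_on_empty)
  next
    case False
    have "closed (I j)"
    proof -
      have "I j = {a..b} \<inter> (\<lambda>x. \<bar>h x - real j\<bar>) -` {..\<delta>}" by (auto simp: I_def)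
      moreover have "closed ({a..b} \<inter> (\<lambda>x. \<bar>h x - real j\<bar>) -` {..\<delta>})"
        by (rule continuous_closed_preimage) (auto intro!: continuous_intros h(1))
      ultimately show ?thesis by simp
    qed
    moreover have "bounded (I j)" by (rule bounded_subset[of "{a..b}"]) (auto simp: I_def)
    ultimately have "compact (I j)" by (simp add: compact_eq_bounded_closed)
    \<comment> \<open>Monotonicity of h makes each preimage an interval, so that the bound for a
      single interval applies to it.\<close>
    moreover have "is_interval (I j)"
      unfolding is_interval_1
    proof (intro ballI allI impI)
      fix x y z assume A: "x \<in> I j" "y \<in> I j" "x \<le> z \<and> z \<le> y"
      then have z: "z \<in> {a..b}" "x \<in> {a..b}" "y \<in> {a..b}" by (auto simp: I_def)
      then have "h x \<le> h z" "h z \<le> h y" using A h(2) by (auto simp: mono_on_def)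
      then show "z \<in> I j" using A z by (auto simp: I_def)
    qed
    ultimately obtain p q where pq: "I j = {p..q}"
      using connected_compact_interval_1[of "I j"] is_interval_connected_1[of "I j"] by (auto simp: box_real)
    with False have "p \<le> q" by simp
    have "I j \<subseteq> {a..b}" by (auto simp: I_def)
    then have sub: "{p..q} \<subseteq> {a..b}" unfolding pq .
    have p: "p \<in> I j" unfolding pq using \<open>p \<le> q\<close> by simp
    then have pab: "p \<in> {a..b}" by (auto simp: I_def)
    have *: "(\<lambda>x. near_int \<epsilon> (g x) - 2 * \<epsilon>) integrable_on {p..q}"
      "\<bar>integral {p..q} (\<lambda>x. near_int \<epsilon> (g x) - 2 * \<epsilon>)\<bar> \<le> 2 * \<epsilon> / g' p"
      by (rule integral_near_int_bound[OF \<epsilon> \<open>p \<le> q\<close> g g' continuous_on_subset[OF g'' sub] pos cvx];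
          use sub in blast)+
    have "inverse (max 1 (h p)) \<le> w j"
    proof (cases "j = 0")
      case True
      then show ?thesis by (simp add: w_def inverse_le_1_iff)
    next
      case False
      have "real j / 2 \<le> max 1 (h p)" using p \<delta> by (auto simp: I_def)
      then have "inverse (max 1 (h p)) \<le> inverse (real j / 2)" using False by (intro le_imp_inverse_le) auto
      then show ?thesis using False by (simp add: w_def)
    qed
    have "2 * \<epsilon> / g' p \<le> 2 * \<epsilon> / (L * max 1 (h p))"
      using \<epsilon> L g'_ge[OF pab] by (intro divide_left_mono mult_pos_pos pos pab) auto
    also have "\<dots> = 2 * \<epsilon> / L * inverse (max 1 (h p))" by (simp add: field_simps)
    also have "\<dots> \<le> 2 * \<epsilon> / L * w j" using \<open>_ \<le> w j\<close> \<epsilon> L by (intro mult_left_mono) auto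
    finally show ?thesis using * pq by (simp add: X_def)
  qed
  have sub: "I j \<inter> {a..b} = I j" for j by (auto simp: I_def)
  have int: "(\<lambda>x. if x \<in> I j then X x else 0) integrable_on {a..b}"
    "integral {a..b} (\<lambda>x. if x \<in> I j then X x else 0) = integral (I j) X" for j
    using piece[of j] by (simp_all add: integrable_restrict_Int Henstock_Kurzweil_Integration.integral_restrict_Int sub Int_commute)
  have "integral {a..b} (\<lambda>x. X x * near_int \<delta> (h x)) =
      integral {a..b} (\<lambda>x. \<Sum>j\<le>J. if x \<in> I j then X x else 0)"
    by (rule integral_cong) (simp add: split sum_distrib_left if_distrib of_bool_def cong: if_cong)
  also have "\<dots> = (\<Sum>j\<le>J. integral (I j) X)"
    using int by (simp add: integral_sum)
  finally have "\<bar>integral {a..b} (\<lambda>x. X x * near_int \<delta> (h x))\<bar> \<le> (\<Sum>j\<le>J. \<bar>integral (I j) X\<bar>)"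
    by simp
  also have "\<dots> \<le> (\<Sum>j\<le>J. 2 * \<epsilon> / L * w j)" using piece by (intro sum_mono) blast
  also have "\<dots> = 2 * \<epsilon> / L * (\<Sum>j\<le>J. w j)" by (simp add: sum_distrib_left)
  also have "\<dots> \<le> 2 * \<epsilon> / L * (3 + 2 * ln (H + 1))"
  proof (intro mult_left_mono)
    have "(\<Sum>j\<le>J. w j) = 1 + (\<Sum>j=1..J. w j)"
      by (simp add: atMost_atLeast0 sum.atLeast_Suc_atMost w_def)
    also have "(\<Sum>j=1..J. w j) = 2 * harm J"
      unfolding harm_def sum_distrib_left by (intro sum.cong) (auto simp: w_def field_simps)
    also have "harm J \<le> 1 + ln (H + 1)"
    proof (cases "J = 0")
      case False
      have "real J \<le> H + 1" using \<open>H \<ge> 0\<close> unfolding J_def by linarith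
      with False have "ln (real J) \<le> ln (H + 1)" by simp
      then show ?thesis using harm_le_ln[of J] False by simp
    qed (use \<open>H \<ge> 0\<close> in \<open>simp add: harm_def\<close>)
    finally show "(\<Sum>j\<le>J. w j) \<le> 3 + 2 * ln (H + 1)" by simp
  qed (use \<epsilon> L in auto)
  finally show ?thesis unfolding X_def .
qed

subsection \<open>Pair counts\<close>

text \<open>By monotone convergence the sum of the squares has a finite integral. It is therefore
  finite almost everywhere, and the terms of a convergent series tend to 0.\<close>

lemma AE_tendsto_zero_if_summable_squares:
  fixes Y :: "nat \<Rightarrow> 'a \<Rightarrow> real"
  assumes int: "\<And>k. integrable M (\<lambda>\<omega>. (Y k \<omega>)\<^sup>2)"
    and sum: "summable (\<lambda>k. \<integral>\<omega>. (Y k \<omega>)\<^sup>2 \<partial>M)"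
  shows "AE \<omega> in M. (\<lambda>k. Y k \<omega>) \<longlonglongrightarrow> 0"
proof -
  have meas: "(\<lambda>\<omega>. ennreal ((Y k \<omega>)\<^sup>2)) \<in> borel_measurable M" for k
    using int[of k] by (intro measurable_compose[OF _ measurable_ennreal]) auto
  have "(\<integral>\<^sup>+\<omega>. (\<Sum>k. ennreal ((Y k \<omega>)\<^sup>2)) \<partial>M) = (\<Sum>k. \<integral>\<^sup>+\<omega>. ennreal ((Y k \<omega>)\<^sup>2) \<partial>M)"
    by (rule nn_integral_suminf[OF meas])
  also have "\<dots> = (\<Sum>k. ennreal (\<integral>\<omega>. (Y k \<omega>)\<^sup>2 \<partial>M))"
    by (intro suminf_cong nn_integral_eq_integral int) auto
  also have "\<dots> \<noteq> \<infinity>"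
    using sum by (simp add: suminf_ennreal2)
  finally have "(\<integral>\<^sup>+\<omega>. (\<Sum>k. ennreal ((Y k \<omega>)\<^sup>2)) \<partial>M) \<noteq> \<infinity>" .
  then have "AE \<omega> in M. (\<Sum>k. ennreal ((Y k \<omega>)\<^sup>2)) \<noteq> \<infinity>"
    by (intro nn_integral_PInf_AE) (use meas in measurable)
  then show ?thesis
  proof eventually_elim
    case (elim \<omega>)
    then have "summable (\<lambda>k. (Y k \<omega>)\<^sup>2)"
      by (intro summable_suminf_not_top) auto
    then have "(\<lambda>k. (Y k \<omega>)\<^sup>2) \<longlonglongrightarrow> 0" by (rule summable_LIMSEQ_zero)
    then have "(\<lambda>k. sqrt ((Y k \<omega>)\<^sup>2)) \<longlonglongrightarrow> sqrt 0" by (rule tendsto_real_sqrt)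
    then show ?case by (simp add: tendsto_rabs_zero_iff)
  qed
qed

section \<open>Pair counts and their interpolation between squares\<close>

definition pair_count :: "(nat \<Rightarrow> real) \<Rightarrow> nat \<Rightarrow> real \<Rightarrow> nat" where
  "pair_count u N \<epsilon> = card {(m, n) \<in> {1..N} \<times> {1..N}. m \<noteq> n \<and> dist_nearest_int (u n - u m) \<le> \<epsilon>}"

lemma pair_count_mono:
  assumes "N \<le> N'" "\<epsilon> \<le> \<epsilon>'"
  shows "pair_count u N \<epsilon> \<le> pair_count u N' \<epsilon>'"
  unfolding pair_count_def
proof (rule card_mono)
  show "finite {(m, n) \<in> {1..N'} \<times> {1..N'}. m \<noteq> n \<and> dist_nearest_int (u n - u m) \<le> \<epsilon>'}"
    by (rule finite_subset[of _ "{1..N'} \<times> {1..N'}"]) auto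
qed (use assms in auto)

text \<open>For N between k^2 and (k + 1)^2 the count is squeezed between the counts at these
  squares, with s replaced by a slightly smaller or larger rational. Assuming the limit for rational
  s only means that countably many null sets have to be discarded later.\<close>

lemma pair_count_interpolation:
  assumes lim: "\<And>s. s \<in> \<rat> \<Longrightarrow> s > 0 \<Longrightarrow>
      (\<lambda>k. real (pair_count u (k\<^sup>2) (s / real (k\<^sup>2))) / real (k\<^sup>2)) \<longlonglongrightarrow> 2 * s"
  shows "poissonian_pair_correlations u"
  unfolding poissonian_pair_correlations_def pair_count_def[symmetric]
proof (intro allI impI)
  fix s :: real assume s: "s > 0"
  define R where "R = (\<lambda>s k. real (pair_count u (k\<^sup>2) (s / real (k\<^sup>2))) / real (k\<^sup>2))"
  define k where "k = (\<lambda>N. nat \<lfloor>sqrt (real N)\<rfloor>)"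
  have k_le: "real (k N) \<le> sqrt (real N)" and k_gt: "sqrt (real N) < real (k N) + 1" for N
    unfolding k_def by (simp_all add: of_nat_nat)
  have k1: "(k N)\<^sup>2 \<le> N" for N
  proof -
    have "(real (k N))\<^sup>2 \<le> (sqrt (real N))\<^sup>2" using k_le by (intro power_mono) auto
    then have "real ((k N)\<^sup>2) \<le> real N" by simp
    then show ?thesis by linarith
  qed
  have k2: "N \<le> (Suc (k N))\<^sup>2" for N
  proof -
    have "(sqrt (real N))\<^sup>2 \<le> (real (k N) + 1)\<^sup>2"
      using k_gt[of N] by (intro power_mono) auto
    then have "real N \<le> real ((Suc (k N))\<^sup>2)" by (simp add: add.commute)
    then show ?thesis by linarith
  qed
  have k_top: "filterlim k at_top sequentially"
    unfolding k_def
    by (intro filterlim_compose[OF filterlim_nat_sequentially]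
        filterlim_compose[OF filterlim_floor_sequentially]
        filterlim_compose[OF sqrt_at_top] filterlim_real_sequentially)
  have Sk_top: "filterlim (\<lambda>N. Suc (k N)) at_top sequentially"
    using filterlim_compose[OF filterlim_Suc k_top] by simp
  \<comment> \<open>The ratio of consecutive squares measures the loss, in the threshold and in the
    normalisation, when N is replaced by a neighbouring square.\<close>
  define \<rho> where "\<rho> = (\<lambda>k::nat. real ((Suc k)\<^sup>2) / real (k\<^sup>2))"
  have \<rho>: "\<rho> \<longlonglongrightarrow> 1"
  proof -
    have "(\<lambda>k::nat. (1 + inverse (real k))\<^sup>2) \<longlonglongrightarrow> (1 + 0)\<^sup>2"
      by (intro tendsto_intros lim_inverse_n)
    moreover have "\<forall>\<^sub>F k in sequentially. (1 + inverse (real k))\<^sup>2 = \<rho> k"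
      using eventually_gt_at_top[of 0]
      by eventually_elim (simp add: \<rho>_def field_simps power2_eq_square)
    ultimately show ?thesis by (simp add: tendsto_cong)
  qed
  have pos: "\<forall>\<^sub>F N in sequentially. k N > 0 \<and> N > 0"
    by (intro eventually_conj eventually_compose_filterlim[OF eventually_gt_at_top k_top] eventually_gt_at_top)
  have upper: "\<forall>\<^sub>F N in sequentially. real (pair_count u N (s / real N)) / real N < e" if e: "2 * s < e" for e
  proof -
    \<comment> \<open>The slack t > s absorbs \<rho> in the threshold: \<rho> < t / s gives s / N
      \<le> t / (k + 1)^2. The slack 2 * t < e absorbs \<rho> in the normalisation.\<close>
    obtain t where t: "t \<in> \<rat>" "s < t" "t < e / 2"
      using Rats_dense_in_real[of s "e/2"] e by auto
    have "(\<lambda>N. R t (Suc (k N)) * \<rho> (k N)) \<longlonglongrightarrow> 2 * t * 1"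
      using lim[OF t(1)] s t(2) unfolding R_def
      by (intro tendsto_mult filterlim_compose[OF _ Sk_top] filterlim_compose[OF \<rho> k_top]) auto
    then have "\<forall>\<^sub>F N in sequentially. R t (Suc (k N)) * \<rho> (k N) < e"
      by (rule order_tendstoD) (use t in simp)
    moreover have "\<forall>\<^sub>F N in sequentially. \<rho> (k N) < t / s"
      using filterlim_compose[OF \<rho> k_top] t s by (intro order_tendstoD(2)[where y = 1]) auto
    ultimately show ?thesis using pos
    proof eventually_elim
      case (elim N)
      let ?k = "k N"
      have kp: "0 < real (?k\<^sup>2)" using elim by simp
      have "s / real N \<le> s / real (?k\<^sup>2)" using kp k1[of N] s elim
        by (intro divide_left_mono mult_pos_pos) (auto simp: of_nat_power[symmetric] simp del: of_nat_power)
      also have "\<dots> = s * \<rho> ?k / real ((Suc ?k)\<^sup>2)" unfolding \<rho>_def by (simp del: of_nat_Suc)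
      also have "\<dots> \<le> t / real ((Suc ?k)\<^sup>2)" using elim s by (intro divide_right_mono) (auto simp: field_simps)
      finally have "pair_count u N (s / real N) \<le> pair_count u ((Suc ?k)\<^sup>2) (t / real ((Suc ?k)\<^sup>2))"
        using k2 by (intro pair_count_mono) auto
      then have "real (pair_count u N (s / real N)) / real N \<le>
          real (pair_count u ((Suc ?k)\<^sup>2) (t / real ((Suc ?k)\<^sup>2))) / real (?k\<^sup>2)"
        using kp k1[of N] by (intro frac_le) (auto simp: of_nat_power[symmetric] simp del: of_nat_power)
      also have "\<dots> = R t (Suc ?k) * \<rho> ?k"
        unfolding R_def \<rho>_def by (simp del: of_nat_Suc)
      finally show ?case using elim by linarith
    qed
  qed
  have lower: "\<forall>\<^sub>F N in sequentially. e < real (pair_count u N (s / real N)) / real N" if e: "e < 2 * s" for e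
  proof -
    \<comment> \<open>Mirror image of the upper bound: t lies below s, so that \<rho> < s / t gives
      t / k^2 \<le> s / N; the maximum with 0 keeps t positive.\<close>
    obtain t where t: "t \<in> \<rat>" "max 0 (e/2) < t" "t < s"
      using Rats_dense_in_real[of "max 0 (e/2)" s] e s by auto
    have "(\<lambda>N. R t (k N) / \<rho> (k N)) \<longlonglongrightarrow> 2 * t / 1"
      using lim[OF t(1)] s t(2) unfolding R_def
      by (intro tendsto_divide filterlim_compose[OF _ k_top] filterlim_compose[OF \<rho> k_top]) auto
    then have "\<forall>\<^sub>F N in sequentially. R t (k N) / \<rho> (k N) > e"
      by (rule order_tendstoD) (use t in simp)
    moreover have "\<forall>\<^sub>F N in sequentially. \<rho> (k N) < s / t"
      using filterlim_compose[OF \<rho> k_top] t s by (intro order_tendstoD(2)[where y = 1]) auto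
    ultimately show ?thesis using pos
    proof eventually_elim
      case (elim N)
      let ?k = "k N"
      have kp: "0 < real (?k\<^sup>2)" using elim by simp
      have "t / real (?k\<^sup>2) = t * \<rho> ?k / real ((Suc ?k)\<^sup>2)" unfolding \<rho>_def by (simp del: of_nat_Suc)
      also have "\<dots> \<le> s / real ((Suc ?k)\<^sup>2)" using elim t by (intro divide_right_mono) (auto simp: field_simps)
      also have "\<dots> \<le> s / real N" using k2[of N] s elim
        by (intro divide_left_mono) (auto simp: of_nat_power[symmetric] simp del: of_nat_power of_nat_Suc)
      finally have le: "pair_count u (?k\<^sup>2) (t / real (?k\<^sup>2)) \<le> pair_count u N (s / real N)"
        using k1 by (intro pair_count_mono) auto
      have "R t ?k / \<rho> ?k = real (pair_count u (?k\<^sup>2) (t / real (?k\<^sup>2))) / real ((Suc ?k)\<^sup>2)"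
        unfolding R_def \<rho>_def using kp by (simp del: of_nat_Suc)
      also have "\<dots> \<le> real (pair_count u N (s / real N)) / real N"
        using le k2[of N] elim by (intro frac_le) (auto simp: of_nat_power[symmetric] simp del: of_nat_power of_nat_Suc)
      finally show ?case using elim by linarith
    qed
  qed
  show "(\<lambda>N. real (pair_count u N (s / real N)) / real N) \<longlonglongrightarrow> 2 * s"
    by (rule order_tendstoI) (use upper lower in auto)
qed

section \<open>Unordered pairs, sorted by their larger index\<close>

text \<open>The larger index comes first: \<open>fst\<close> is the top index, which governs how
  fast the difference oscillates.\<close>

definition pairs_upto :: "nat \<Rightarrow> (nat \<times> nat) set" where
  "pairs_upto N = (SIGMA n:{1..N}. {1..<n})"

lemma finite_pairs_upto [simp]: "finite (pairs_upto N)"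
  by (simp add: pairs_upto_def)

lemma sum_pairs_upto_fst:
  fixes F :: "nat \<Rightarrow> real"
  shows "(\<Sum>P\<in>pairs_upto N. F (fst P)) = (\<Sum>n=1..N. real (n - 1) * F n)"
  unfolding pairs_upto_def by (subst sum.Sigma[symmetric, where g = "\<lambda>n m. F n", unfolded case_prod_unfold]) auto

lemma card_pairs_upto: "2 * card (pairs_upto N) = N * (N - 1)"
proof -
  have "card (pairs_upto N) = (\<Sum>n=1..N. n - 1)"
    unfolding pairs_upto_def by simp
  moreover have "2 * (\<Sum>n=1..N. n - 1) = N * (N - 1)"
    by (induction N) (auto simp: algebra_simps diff_mult_distrib2)
  ultimately show ?thesis by simp
qed

text \<open>The distance to the nearest integer is even, so the counted ordered pairs split into the
  sorted ones and their mirror images.\<close>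

lemma pair_count_eq_sum:
  "real (pair_count u N \<epsilon>) = 2 * (\<Sum>(n, m)\<in>pairs_upto N. near_int \<epsilon> (u n - u m))"
proof -
  define T where "T = {(n, m) \<in> pairs_upto N. dist_nearest_int (u n - u m) \<le> \<epsilon>}"
  have finT: "finite T" unfolding T_def by (rule finite_subset[OF _ finite_pairs_upto[of N]]) auto
  have sym: "dist_nearest_int (u n - u m) = dist_nearest_int (u m - u n)" for m n
    using dist_nearest_int_minus[of "u n - u m"] by simp
  have "{(m, n) \<in> {1..N} \<times> {1..N}. m \<noteq> n \<and> dist_nearest_int (u n - u m) \<le> \<epsilon>} = T \<union> prod.swap ` T"
    (is "?S = _")
  proof (intro equalityI subsetI)
    fix p assume "p \<in> ?S"
    then obtain m n where p: "p = (m, n)" "m \<in> {1..N}" "n \<in> {1..N}" "m \<noteq> n" "dist_nearest_int (u n - u m) \<le> \<epsilon>" by auto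
    show "p \<in> T \<union> prod.swap ` T"
    proof (cases "m < n")
      case True
      then have "(n, m) \<in> T" using p by (auto simp: T_def pairs_upto_def)
      then show ?thesis using p by force
    next
      case False
      then have "(m, n) \<in> T" using p sym[of n m] by (auto simp: T_def pairs_upto_def)
      then show ?thesis using p by simp
    qed
  next
    fix p assume "p \<in> T \<union> prod.swap ` T"
    then show "p \<in> ?S" using sym by (fastforce simp: T_def pairs_upto_def)
  qed
  moreover have "T \<inter> prod.swap ` T = {}" by (fastforce simp: T_def pairs_upto_def)
  ultimately have "pair_count u N \<epsilon> = card T + card (prod.swap ` T)"
    unfolding pair_count_def using finT by (simp add: card_Un_disjoint)
  also have "card (prod.swap ` T) = card T" by (rule card_image) simp
  finally have "real (pair_count u N \<epsilon>) = 2 * real (card T)" by simp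
  also have "real (card T) = (\<Sum>(n, m)\<in>pairs_upto N. near_int \<epsilon> (u n - u m))"
  proof -
    have "T = {P \<in> pairs_upto N. dist_nearest_int (u (fst P) - u (snd P)) \<le> \<epsilon>}"
      by (auto simp: T_def)
    then show ?thesis
      unfolding near_int_def case_prod_unfold by (simp add: Int_def)
  qed
  finally show ?thesis .
qed

subsection \<open>The second moment argument\<close>

text \<open>Separates the probabilistic argument from the analysis. The total mass of M is
  arbitrary. The slower indicator is uncentred and has its own threshold \<delta> because two pairs
  with a common top index lead to a slower pair with threshold 2 * \<epsilon>.\<close>

locale decorrelated_differences = finite_measure M for M :: "'a measure" +
  fixes x :: "nat \<Rightarrow> 'a \<Rightarrow> real" and K :: real
  assumes x_measurable [measurable]: "\<And>n. x n \<in> borel_measurable M"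
    and mean_bound: "\<And>\<epsilon> m n. 0 < \<epsilon> \<Longrightarrow> \<epsilon> < 1/2 \<Longrightarrow> 1 \<le> m \<Longrightarrow> m < n \<Longrightarrow>
      \<bar>\<integral>\<omega>. near_int \<epsilon> (x n \<omega> - x m \<omega>) - 2 * \<epsilon> \<partial>M\<bar> \<le> K * \<epsilon> / (real n)\<^sup>2"
    and correlation_bound: "\<And>\<epsilon> \<delta> m n m' n'. 0 < \<epsilon> \<Longrightarrow> \<epsilon> < 1/2 \<Longrightarrow> 0 < \<delta> \<Longrightarrow> \<delta> < 1/2 \<Longrightarrow>
      1 \<le> m \<Longrightarrow> m < n \<Longrightarrow> 1 \<le> m' \<Longrightarrow> m' < n' \<Longrightarrow> n' < n \<Longrightarrow>
      \<bar>\<integral>\<omega>. (near_int \<epsilon> (x n \<omega> - x m \<omega>) - 2 * \<epsilon>) * near_int \<delta> (x n' \<omega> - x m' \<omega>) \<partial>M\<bar>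
        \<le> K * \<epsilon> / (real n)\<^sup>2"
begin

section \<open>Means and correlations of the pair indicators\<close>

definition pair_near :: "real \<Rightarrow> nat \<times> nat \<Rightarrow> 'a \<Rightarrow> real" where
  "pair_near \<epsilon> P \<omega> = near_int \<epsilon> (x (fst P) \<omega> - x (snd P) \<omega>)"

lemma pair_near_measurable [measurable]: "pair_near \<epsilon> P \<in> borel_measurable M"
  unfolding pair_near_def by measurable

lemma pair_near_range: "0 \<le> pair_near \<epsilon> P \<omega>" "pair_near \<epsilon> P \<omega> \<le> 1"
  unfolding pair_near_def by (rule near_int_range)+

lemma pair_near_idem: "pair_near \<epsilon> P \<omega> * pair_near \<epsilon> P \<omega> = pair_near \<epsilon> P \<omega>"
  unfolding pair_near_def near_int_def by simp

lemma integrable_pair_near [simp, intro]: "integrable M (pair_near \<epsilon> P)"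
  using pair_near_range by (intro integrable_const_bound[where B = 1]) auto

lemma integrable_pair_near_mult [simp, intro]: "integrable M (\<lambda>\<omega>. pair_near \<epsilon> P \<omega> * pair_near \<delta> Q \<omega>)"
proof (intro integrable_const_bound[where B = 1] AE_I2)
  fix \<omega>
  show "norm (pair_near \<epsilon> P \<omega> * pair_near \<delta> Q \<omega>) \<le> 1"
    using pair_near_range[of \<epsilon> P \<omega>] pair_near_range[of \<delta> Q \<omega>] by (simp add: mult_le_one)
qed measurable

abbreviation \<mu> :: real where "\<mu> \<equiv> measure M (space M)"

lemma K_nonneg: "0 \<le> K"
  using mean_bound[of "1/4" 1 2] by (simp add: divide_simps)

lemma integral_pair_near_le:
  assumes "0 < \<epsilon>" "\<epsilon> < 1/2" "P \<in> pairs_upto N"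
  shows "(\<integral>\<omega>. pair_near \<epsilon> P \<omega> \<partial>M) \<le> \<epsilon> * (2 * \<mu> + K)"
proof -
  obtain n m where P: "P = (n, m)" "1 \<le> m" "m < n" using assms by (auto simp: pairs_upto_def)
  have "(\<integral>\<omega>. pair_near \<epsilon> P \<omega> \<partial>M) - 2 * \<epsilon> * \<mu> = (\<integral>\<omega>. pair_near \<epsilon> P \<omega> - 2 * \<epsilon> \<partial>M)"
    by simp
  also have "\<dots> \<le> K * \<epsilon> / (real n)\<^sup>2"
    using mean_bound[OF assms(1,2) P(2,3)] by (simp add: pair_near_def P)
  also have "\<dots> \<le> K * \<epsilon> / 1"
    using P assms K_nonneg by (intro divide_left_mono) auto
  finally show ?thesis by (simp add: algebra_simps)
qed

text \<open>If two pairs share their larger index \<open>n\<close>, then closeness of both \<open>x m\<close> and \<open>x m'\<close> to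
  \<open>x n\<close> modulo 1 makes \<open>x m\<close> and \<open>x m'\<close> close to each other, so a pair with a smaller top index
  takes over.\<close>

lemma integral_pair_near_mult_same_top:
  assumes \<epsilon>: "0 < \<epsilon>" "\<epsilon> < 1/4" and m: "1 \<le> m" "m < m'" "m' < n"
  shows "(\<integral>\<omega>. pair_near \<epsilon> (n, m) \<omega> * pair_near \<epsilon> (n, m') \<omega> \<partial>M)
           \<le> K * \<epsilon> / (real n)\<^sup>2 + \<epsilon>\<^sup>2 * (8 * \<mu> + 4 * K)"
proof -
  have "pair_near \<epsilon> (n, m) \<omega> * pair_near \<epsilon> (n, m') \<omega> \<le> pair_near \<epsilon> (n, m') \<omega> * pair_near (2 * \<epsilon>) (m', m) \<omega>" for \<omega>
    using dist_nearest_int_diff_le[of "x n \<omega> - x m \<omega>" "x n \<omega> - x m' \<omega>"]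
    by (auto simp: pair_near_def near_int_def)
  then have "(\<integral>\<omega>. pair_near \<epsilon> (n, m) \<omega> * pair_near \<epsilon> (n, m') \<omega> \<partial>M)
      \<le> (\<integral>\<omega>. pair_near \<epsilon> (n, m') \<omega> * pair_near (2 * \<epsilon>) (m', m) \<omega> \<partial>M)"
    by (intro integral_mono) auto
  \<comment> \<open>Centring the faster factor leaves a correlation term and 2 * \<epsilon> times a
    mean of order \<epsilon>. The condition \<epsilon> < 1/4 keeps the threshold 2 * \<epsilon> of
    the slower pair below 1/2.\<close>
  also have "\<dots> = (\<integral>\<omega>. (pair_near \<epsilon> (n, m') \<omega> - 2 * \<epsilon>) * pair_near (2 * \<epsilon>) (m', m) \<omega> \<partial>M)
      + 2 * \<epsilon> * (\<integral>\<omega>. pair_near (2 * \<epsilon>) (m', m) \<omega> \<partial>M)"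
    by (simp add: left_diff_distrib)
  also have "\<dots> \<le> K * \<epsilon> / (real n)\<^sup>2 + 2 * \<epsilon> * (2 * \<epsilon> * (2 * \<mu> + K))"
  proof (intro add_mono mult_left_mono)
    show "(\<integral>\<omega>. (pair_near \<epsilon> (n, m') \<omega> - 2 * \<epsilon>) * pair_near (2 * \<epsilon>) (m', m) \<omega> \<partial>M) \<le> K * \<epsilon> / (real n)\<^sup>2"
      using correlation_bound[of \<epsilon> "2 * \<epsilon>" m' n m m'] assms by (simp add: pair_near_def)
    show "(\<integral>\<omega>. pair_near (2 * \<epsilon>) (m', m) \<omega> \<partial>M) \<le> 2 * \<epsilon> * (2 * \<mu> + K)"
      using assms by (intro integral_pair_near_le[where N = m']) (auto simp: pairs_upto_def)
  qed (use \<epsilon> in auto)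
  finally show ?thesis by (simp add: algebra_simps power2_eq_square)
qed

lemma integral_centred_mult_expand:
  "(\<integral>\<omega>. (pair_near \<epsilon> P \<omega> - 2 * \<epsilon>) * (pair_near \<epsilon> Q \<omega> - 2 * \<epsilon>) \<partial>M) =
     (\<integral>\<omega>. pair_near \<epsilon> P \<omega> * pair_near \<epsilon> Q \<omega> \<partial>M) - 2 * \<epsilon> * (\<integral>\<omega>. pair_near \<epsilon> P \<omega> \<partial>M) - 2 * \<epsilon> * (\<integral>\<omega>. pair_near \<epsilon> Q \<omega> \<partial>M)
       + 4 * \<epsilon>\<^sup>2 * \<mu>"
proof -
  have "(\<integral>\<omega>. (pair_near \<epsilon> P \<omega> - 2 * \<epsilon>) * (pair_near \<epsilon> Q \<omega> - 2 * \<epsilon>) \<partial>M) =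
      (\<integral>\<omega>. pair_near \<epsilon> P \<omega> * pair_near \<epsilon> Q \<omega> - 2 * \<epsilon> * pair_near \<epsilon> P \<omega> - 2 * \<epsilon> * pair_near \<epsilon> Q \<omega> + 4 * \<epsilon>\<^sup>2 \<partial>M)"
    by (intro Bochner_Integration.integral_cong) (auto simp: algebra_simps power2_eq_square)
  then show ?thesis by simp
qed

lemma integral_pair_near_nonneg: "0 \<le> (\<integral>\<omega>. pair_near \<epsilon> P \<omega> \<partial>M)"
  by (intro integral_nonneg_AE AE_I2 pair_near_range)

lemma integral_centred_mult_le_product:
  assumes "0 < \<epsilon>"
  shows "(\<integral>\<omega>. (pair_near \<epsilon> P \<omega> - 2 * \<epsilon>) * (pair_near \<epsilon> Q \<omega> - 2 * \<epsilon>) \<partial>M)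
    \<le> (\<integral>\<omega>. pair_near \<epsilon> P \<omega> * pair_near \<epsilon> Q \<omega> \<partial>M) + 4 * \<epsilon>\<^sup>2 * \<mu>"
proof -
  have "0 \<le> 2 * \<epsilon> * (\<integral>\<omega>. pair_near \<epsilon> P \<omega> \<partial>M)" "0 \<le> 2 * \<epsilon> * (\<integral>\<omega>. pair_near \<epsilon> Q \<omega> \<partial>M)"
    using assms integral_pair_near_nonneg by (intro mult_nonneg_nonneg; simp)+
  then show ?thesis unfolding integral_centred_mult_expand by linarith
qed

text \<open>Cancellation comes from the factor with the larger top index alone. Expanding the other
  one gives a correlation and a mean, and the mean carries the weight 2 * \<epsilon> < 1.\<close>

lemma integral_centred_mult_lt:
  assumes \<epsilon>: "0 < \<epsilon>" "\<epsilon> < 1/2" and "(n, m) \<in> pairs_upto N" "(n', m') \<in> pairs_upto N" "n' < n"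
  shows "(\<integral>\<omega>. (pair_near \<epsilon> (n, m) \<omega> - 2 * \<epsilon>) * (pair_near \<epsilon> (n', m') \<omega> - 2 * \<epsilon>) \<partial>M) \<le> 2 * K * \<epsilon> / (real n)\<^sup>2"
proof -
  have m: "1 \<le> m" "m < n" "1 \<le> m'" "m' < n'" using assms by (auto simp: pairs_upto_def)
  let ?a = "\<integral>\<omega>. (pair_near \<epsilon> (n, m) \<omega> - 2 * \<epsilon>) * pair_near \<epsilon> (n', m') \<omega> \<partial>M"
  let ?b = "\<integral>\<omega>. pair_near \<epsilon> (n, m) \<omega> - 2 * \<epsilon> \<partial>M"
  have "(\<integral>\<omega>. (pair_near \<epsilon> (n, m) \<omega> - 2 * \<epsilon>) * (pair_near \<epsilon> (n', m') \<omega> - 2 * \<epsilon>) \<partial>M) = ?a - 2 * \<epsilon> * ?b"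
    unfolding integral_centred_mult_expand by (simp add: algebra_simps power2_eq_square)
  also have "\<dots> \<le> K * \<epsilon> / (real n)\<^sup>2 + 1 * (K * \<epsilon> / (real n)\<^sup>2)"
  proof -
    have "?a \<le> K * \<epsilon> / (real n)\<^sup>2"
      using correlation_bound[of \<epsilon> \<epsilon> m n m' n'] assms m by (simp add: pair_near_def)
    moreover have "2 * \<epsilon> * \<bar>?b\<bar> \<le> 1 * (K * \<epsilon> / (real n)\<^sup>2)"
      using mean_bound[OF \<epsilon> m(1,2)] \<epsilon> by (intro mult_mono) (auto simp: pair_near_def)
    moreover have "- (2 * \<epsilon> * ?b) \<le> 2 * \<epsilon> * \<bar>?b\<bar>"
      using abs_ge_minus_self[of "2 * \<epsilon> * ?b"] \<epsilon> by (simp add: abs_mult)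
    ultimately show ?thesis by linarith
  qed
  finally show ?thesis by simp
qed

text \<open>The three summands pay for decorrelation, for a shared top index and for the diagonal.
  On the diagonal the square of an indicator is the indicator itself, which costs a mean of order
  \<epsilon>.\<close>

lemma integral_centred_mult:
  assumes \<epsilon>: "0 < \<epsilon>" "\<epsilon> < 1/4" and P: "P \<in> pairs_upto N" and Q: "Q \<in> pairs_upto N"
  shows "(\<integral>\<omega>. (pair_near \<epsilon> P \<omega> - 2 * \<epsilon>) * (pair_near \<epsilon> Q \<omega> - 2 * \<epsilon>) \<partial>M)
    \<le> 2 * K * \<epsilon> / (real (max (fst P) (fst Q)))\<^sup>2
      + (if fst P = fst Q then \<epsilon>\<^sup>2 * (12 * \<mu> + 4 * K) else 0)
      + (if P = Q then \<epsilon> * (2 * \<mu> + K) else 0)" (is "?I P Q \<le> _")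
proof -
  obtain n m n' m' where PQ: "P = (n, m)" "Q = (n', m')" by (cases P, cases Q)
  have \<epsilon>': "\<epsilon> < 1/2" using \<epsilon> by simp
  have comm: "?I P Q = ?I Q P" by (simp add: mult.commute)
  have m: "1 \<le> m" "m < n" "1 \<le> m'" "m' < n'" using P Q PQ by (auto simp: pairs_upto_def)
  have nn: "0 \<le> K * \<epsilon> / (real n)\<^sup>2" "0 \<le> \<epsilon>\<^sup>2 * K" "0 \<le> \<epsilon>\<^sup>2 * \<mu>" "0 \<le> \<epsilon> * (2 * \<mu> + K)" using K_nonneg \<epsilon> by simp_all
  have same: "?I P Q \<le> K * \<epsilon> / (real n)\<^sup>2 + \<epsilon>\<^sup>2 * (12 * \<mu> + 4 * K)" if "n = n'" "m \<noteq> m'"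
  proof -
    have "(\<integral>\<omega>. pair_near \<epsilon> P \<omega> * pair_near \<epsilon> Q \<omega> \<partial>M) \<le> K * \<epsilon> / (real n)\<^sup>2 + \<epsilon>\<^sup>2 * (8 * \<mu> + 4 * K)"
    proof (cases "m < m'")
      case True
      then show ?thesis using integral_pair_near_mult_same_top[OF \<epsilon> m(1) True] m that PQ by simp
    next
      case False
      then show ?thesis using integral_pair_near_mult_same_top[OF \<epsilon> m(3), of m n] m that PQ by (simp add: mult.commute)
    qed
    then show ?thesis using integral_centred_mult_le_product[OF \<epsilon>(1), of P Q] by (simp add: algebra_simps)
  qed
  consider "n' < n" | "n < n'" | "n = n'" "m \<noteq> m'" | "P = Q" using PQ by fastforce
  then show ?thesis
  proof cases
    case 1
    then show ?thesis using integral_centred_mult_lt[OF \<epsilon>(1) \<epsilon>'] P Q PQ by fastforce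
  next
    case 2
    then show ?thesis using integral_centred_mult_lt[OF \<epsilon>(1) \<epsilon>', of n' m' N n m] P Q PQ comm by auto
  next
    case 3
    then show ?thesis using same PQ nn by auto
  next
    case 4
    have "?I P Q \<le> \<epsilon> * (2 * \<mu> + K) + 4 * \<epsilon>\<^sup>2 * \<mu>"
      using integral_centred_mult_le_product[OF \<epsilon>(1), of P P] integral_pair_near_le[OF \<epsilon>(1) \<epsilon>' P] 4
      by (simp add: pair_near_idem)
    moreover have "0 \<le> 2 * K * \<epsilon> / (real n)\<^sup>2" using K_nonneg \<epsilon> by simp
    moreover have "\<epsilon>\<^sup>2 * (12 * \<mu> + 4 * K) = 12 * (\<epsilon>\<^sup>2 * \<mu>) + 4 * (\<epsilon>\<^sup>2 * K)" by (simp add: algebra_simps)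
    ultimately have "?I P Q \<le> 2 * K * \<epsilon> / (real n)\<^sup>2 + \<epsilon>\<^sup>2 * (12 * \<mu> + 4 * K) + \<epsilon> * (2 * \<mu> + K)"
      using nn by linarith
    then show ?thesis using 4 PQ by simp
  qed
qed

section \<open>Variance of the pair count and convergence along squares\<close>

definition centred_sum :: "real \<Rightarrow> nat \<Rightarrow> 'a \<Rightarrow> real" where
  "centred_sum \<epsilon> N \<omega> = (\<Sum>P\<in>pairs_upto N. pair_near \<epsilon> P \<omega> - 2 * \<epsilon>)"

lemma integrable_centred_mult: "integrable M (\<lambda>\<omega>. (pair_near \<epsilon> P \<omega> - 2 * \<epsilon>) * (pair_near \<epsilon> Q \<omega> - 2 * \<epsilon>))"
  by (simp add: algebra_simps)

lemma centred_sum_square: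
  "(centred_sum \<epsilon> N \<omega>)\<^sup>2 = (\<Sum>P\<in>pairs_upto N. \<Sum>Q\<in>pairs_upto N. (pair_near \<epsilon> P \<omega> - 2 * \<epsilon>) * (pair_near \<epsilon> Q \<omega> - 2 * \<epsilon>))"
  unfolding centred_sum_def power2_eq_square by (rule sum_product)

lemma integrable_centred_sum_square: "integrable M (\<lambda>\<omega>. (centred_sum \<epsilon> N \<omega>)\<^sup>2)"
  unfolding centred_sum_square by (intro Bochner_Integration.integrable_sum integrable_centred_mult)

text \<open>For top indices n and n' there are (n - 1) * (n' - 1) couples of pairs, which the factor
  1 / (max n n')^2 reduces to at most 1. Shared top indices account for at most N^3 couples and the
  diagonal for at most N^2. With \<epsilon> = s / N each term becomes O(N).\<close>

lemma integral_centred_sum_square: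
  assumes \<epsilon>: "0 < \<epsilon>" "\<epsilon> < 1/4"
  shows "(\<integral>\<omega>. (centred_sum \<epsilon> N \<omega>)\<^sup>2 \<partial>M) \<le>
    2 * K * \<epsilon> * (real N)\<^sup>2 + \<epsilon>\<^sup>2 * (12 * \<mu> + 4 * K) * real N ^ 3 + \<epsilon> * (2 * \<mu> + K) * (real N)\<^sup>2"
proof -
  define c1 where "c1 = \<epsilon>\<^sup>2 * (12 * \<mu> + 4 * K)"
  define c2 where "c2 = \<epsilon> * (2 * \<mu> + K)"
  have nn: "c1 \<ge> 0" "c2 \<ge> 0" "0 \<le> 2 * K * \<epsilon>" using K_nonneg \<epsilon> by (auto simp: c1_def c2_def)
  let ?A = "pairs_upto N"
  have "(\<integral>\<omega>. (centred_sum \<epsilon> N \<omega>)\<^sup>2 \<partial>M) =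
      (\<Sum>P\<in>?A. \<Sum>Q\<in>?A. \<integral>\<omega>. (pair_near \<epsilon> P \<omega> - 2 * \<epsilon>) * (pair_near \<epsilon> Q \<omega> - 2 * \<epsilon>) \<partial>M)"
    unfolding centred_sum_square
    by (simp add: Bochner_Integration.integral_sum Bochner_Integration.integrable_sum integrable_centred_mult)
  also have "\<dots> \<le> (\<Sum>P\<in>?A. \<Sum>Q\<in>?A. 2 * K * \<epsilon> / (real (max (fst P) (fst Q)))\<^sup>2
      + (if fst P = fst Q then c1 else 0) + (if P = Q then c2 else 0))"
    unfolding c1_def c2_def by (intro sum_mono integral_centred_mult \<epsilon>)
  also have "\<dots> = 2 * K * \<epsilon> * (\<Sum>P\<in>?A. \<Sum>Q\<in>?A. 1 / (real (max (fst P) (fst Q)))\<^sup>2)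
      + (\<Sum>P\<in>?A. \<Sum>Q\<in>?A. if fst P = fst Q then c1 else 0) + (\<Sum>P\<in>?A. \<Sum>Q\<in>?A. if P = Q then c2 else 0)"
    by (simp add: sum.distrib sum_distrib_left)
  also have "\<dots> \<le> 2 * K * \<epsilon> * (real N)\<^sup>2 + c1 * real N ^ 3 + c2 * (real N)\<^sup>2"
  proof (intro add_mono mult_left_mono nn)
    have "(\<Sum>P\<in>?A. \<Sum>Q\<in>?A. 1 / (real (max (fst P) (fst Q)))\<^sup>2) =
        (\<Sum>n=1..N. \<Sum>n'=1..N. real (n - 1) * (real (n' - 1) * (1 / (real (max n n'))\<^sup>2)))"
      by (simp only: sum_pairs_upto_fst[where F = "\<lambda>n'. 1 / (real (max n n'))\<^sup>2" for n]
          sum_pairs_upto_fst[where F = "\<lambda>n. \<Sum>n'=1..N. real (n' - 1) * (1 / (real (max n n'))\<^sup>2)"] sum_distrib_left)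
    also have "\<dots> \<le> (\<Sum>n=1..N. \<Sum>n'=1..N. 1)"
    proof (intro sum_mono)
      fix n n' assume n: "n \<in> {1..N}" "n' \<in> {1..N}"
      have "real (n - 1) * real (n' - 1) \<le> real (max n n') * real (max n n')"
        by (intro mult_mono) auto
      then show "real (n - 1) * (real (n' - 1) * (1 / (real (max n n'))\<^sup>2)) \<le> 1"
        using n by (simp add: power2_eq_square divide_le_eq)
    qed
    finally show "(\<Sum>P\<in>?A. \<Sum>Q\<in>?A. 1 / (real (max (fst P) (fst Q)))\<^sup>2) \<le> (real N)\<^sup>2"
      by (simp add: power2_eq_square)
  next
    have "(\<Sum>P\<in>?A. \<Sum>Q\<in>?A. if fst P = fst Q then c1 else 0) =
        (\<Sum>n=1..N. real (n - 1) * (\<Sum>n'=1..N. real (n' - 1) * (if n = n' then c1 else 0)))"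
      by (simp only: sum_pairs_upto_fst[where F = "\<lambda>n'. if n = n' then c1 else 0" for n]
          sum_pairs_upto_fst[where F = "\<lambda>n. \<Sum>n'=1..N. real (n' - 1) * (if n = n' then c1 else 0)"])
    also have "\<dots> = (\<Sum>n=1..N. real (n - 1) * (real (n - 1) * c1))"
      by (intro sum.cong refl) (simp add: if_distrib cong: if_cong)
    also have "\<dots> \<le> (\<Sum>n=1..N. real N * (real N * c1))"
      using nn by (intro sum_mono mult_mono mult_nonneg_nonneg) auto
    finally show "(\<Sum>P\<in>?A. \<Sum>Q\<in>?A. if fst P = fst Q then c1 else 0) \<le> c1 * real N ^ 3"
      by (simp add: power3_eq_cube mult_ac)
  next
    have "card ?A \<le> N\<^sup>2"
    proof -
      have "2 * card ?A \<le> N * N" unfolding card_pairs_upto by (intro mult_mono) auto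
      then show ?thesis by (simp add: power2_eq_square)
    qed
    then have "real (card ?A) \<le> (real N)\<^sup>2" by (metis of_nat_le_iff of_nat_power)
    then show "(\<Sum>P\<in>?A. \<Sum>Q\<in>?A. if P = Q then c2 else 0) \<le> c2 * (real N)\<^sup>2"
      using nn by (simp add: mult.commute mult_left_mono)
  qed
  finally show ?thesis unfolding c1_def c2_def .
qed

text \<open>After division by N the second moment of the centred sum is O(1 / N), and 1 / N = 1 /
  k^2 is summable along N = k^2.\<close>

lemma AE_pair_count_squares:
  assumes s: "s > 0"
  shows "AE \<omega> in M. (\<lambda>k. real (pair_count (\<lambda>n. x n \<omega>) (k\<^sup>2) (s / real (k\<^sup>2))) / real (k\<^sup>2)) \<longlonglongrightarrow> 2 * s"
proof -
  define Y where "Y = (\<lambda>k \<omega>. centred_sum (s / real (k\<^sup>2)) (k\<^sup>2) \<omega> / real (k\<^sup>2))"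
  define B where "B = 2 * K * s + s\<^sup>2 * (12 * \<mu> + 4 * K) + s * (2 * \<mu> + K)"
  have "AE \<omega> in M. (\<lambda>k. Y k \<omega>) \<longlonglongrightarrow> 0"
  proof (rule AE_tendsto_zero_if_summable_squares)
    show "integrable M (\<lambda>\<omega>. (Y k \<omega>)\<^sup>2)" for k
      unfolding Y_def power_divide by (intro integrable_divide integrable_centred_sum_square)
    have "\<forall>\<^sub>F k in sequentially. norm (\<integral>\<omega>. (Y k \<omega>)\<^sup>2 \<partial>M) \<le> B * inverse ((real k)\<^sup>2)"
    proof -
      \<comment> \<open>Beyond this point s / k^2 < 1/4, as the second moment bound
        requires.\<close>
      have "\<forall>\<^sub>F k in sequentially. k > nat \<lceil>4 * s\<rceil>" by (rule eventually_gt_at_top)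
      then show ?thesis
      proof eventually_elim
        case (elim k)
        define N where "N = k\<^sup>2"
        have k4: "4 * s < real k" using elim by linarith
        have k1: "1 \<le> k" using elim by simp
        then have "k \<le> N" unfolding N_def by (simp add: power2_eq_square)
        then have N: "4 * s < real N" "0 < real N" using k4 s by linarith+
        have "s / real N < 1/4" using N by (simp add: field_simps)
        then have "(\<integral>\<omega>. (centred_sum (s / real N) N \<omega>)\<^sup>2 \<partial>M) \<le>
          2 * K * (s / real N) * (real N)\<^sup>2 + (s / real N)\<^sup>2 * (12 * \<mu> + 4 * K) * real N ^ 3 + (s / real N) * (2 * \<mu> + K) * (real N)\<^sup>2"
          using s N by (intro integral_centred_sum_square) auto
        also have "\<dots> = B * real N"
          using N unfolding B_def by (simp add: field_simps power2_eq_square power3_eq_cube)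
        finally have *: "(\<integral>\<omega>. (centred_sum (s / real N) N \<omega>)\<^sup>2 \<partial>M) \<le> B * real N" .
        have "(\<integral>\<omega>. (Y k \<omega>)\<^sup>2 \<partial>M) = (\<integral>\<omega>. (centred_sum (s / real N) N \<omega>)\<^sup>2 \<partial>M) / (real N)\<^sup>2"
          unfolding Y_def N_def power_divide by simp
        also have "\<dots> \<le> B * real N / (real N)\<^sup>2" using * by (intro divide_right_mono) auto
        also have "\<dots> = B * inverse ((real k)\<^sup>2)" using N by (simp add: power2_eq_square N_def divide_simps)
        finally show ?case by simp
      qed
    qed
    moreover have "summable (\<lambda>k. B * inverse ((real k)\<^sup>2))"
      by (intro summable_mult inverse_power_summable) simp
    ultimately show "summable (\<lambda>k. \<integral>\<omega>. (Y k \<omega>)\<^sup>2 \<partial>M)"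
      by (rule summable_comparison_test_ev)
  qed
  then show ?thesis
  proof eventually_elim
    case (elim \<omega>)
    \<comment> \<open>Undoing the centring: N * (N - 1) / 2 pairs with mean 2 * s / N, counted in
      both orders, add up to 2 * s * (N - 1), that is 2 * s * (1 - 1 / N) after division by N =
      k^2.\<close>
    have "(\<lambda>k. 2 * Y k \<omega> + 2 * s * (1 - inverse (real k) * inverse (real k))) \<longlonglongrightarrow> 2 * 0 + 2 * s * (1 - 0 * 0)"
      by (intro tendsto_intros elim lim_inverse_n)
    moreover have "\<forall>\<^sub>F k in sequentially. 2 * Y k \<omega> + 2 * s * (1 - inverse (real k) * inverse (real k)) =
        real (pair_count (\<lambda>n. x n \<omega>) (k\<^sup>2) (s / real (k\<^sup>2))) / real (k\<^sup>2)"
      using eventually_gt_at_top[of 0]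
    proof eventually_elim
      case (elim k)
      define N where "N = k\<^sup>2"
      have N: "0 < N" using elim by (simp add: N_def)
      have "real (pair_count (\<lambda>n. x n \<omega>) N (s / real N)) = 2 * (\<Sum>P\<in>pairs_upto N. pair_near (s / real N) P \<omega>)"
        by (simp add: pair_count_eq_sum pair_near_def case_prod_unfold)
      also have "\<dots> = 2 * (centred_sum (s / real N) N \<omega> + real (card (pairs_upto N)) * (2 * (s / real N)))"
        unfolding centred_sum_def by (simp add: sum_subtractf)
      also have "\<dots> = 2 * centred_sum (s / real N) N \<omega> + real (2 * card (pairs_upto N)) * (2 * (s / real N))"
        by simp
      also have "real (2 * card (pairs_upto N)) = real N * (real N - 1)"
        unfolding card_pairs_upto using N by (simp add: of_nat_diff)
      also have "real N * (real N - 1) * (2 * (s / real N)) = 2 * s * (real N - 1)"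
        using N by simp
      finally have "real (pair_count (\<lambda>n. x n \<omega>) N (s / real N)) / real N =
          2 * (centred_sum (s / real N) N \<omega> / real N) + 2 * s * (1 - 1 / real N)"
        using N by (simp add: add_divide_distrib diff_divide_distrib right_diff_distrib)
      moreover have "inverse (real k) * inverse (real k) = 1 / real N"
        by (simp add: N_def power2_eq_square divide_simps)
      ultimately show ?case unfolding Y_def N_def[symmetric] by simp
    qed
    ultimately show ?case by (simp add: tendsto_cong)
  qed
qed

theorem AE_poissonian_pair_correlations:
  "AE \<omega> in M. poissonian_pair_correlations (\<lambda>n. x n \<omega>)"
proof -
  have "AE \<omega> in M. \<forall>s\<in>\<rat> \<inter> {0<..}.
      (\<lambda>k. real (pair_count (\<lambda>n. x n \<omega>) (k\<^sup>2) (s / real (k\<^sup>2))) / real (k\<^sup>2)) \<longlonglongrightarrow> 2 * s"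
    by (intro AE_ball_countable' AE_pair_count_squares countable_Int1 countable_rat) simp
  then show ?thesis
    by eventually_elim (auto intro: pair_count_interpolation)
qed

end

subsection \<open>Polynomials with rapidly growing degrees\<close>

text \<open>Only consecutive indices matter: with \<open>D = d (n + 1) - d n\<close> the growth condition forces
  \<open>n ^ 3 \<le> 2 * D\<^sup>2 * a ^ D\<close>, and the polynomial factor costs less than one power of \<open>n\<close>.\<close>

lemma power_gap_lower_bound:
  fixes d :: "nat \<Rightarrow> nat" and a l :: real
  assumes mono: "strict_mono_on {1..} d" and a: "1 < a" and l: "0 \<le> l"
    and growth: "\<forall>\<^sub>F n1 in sequentially. \<forall>n2>n1.
            (2 * real (d n2) / real (d n1) - 1) * l
            + (real (d n1) - real (d n2)) * ln a
            - ln (real (d n2) * (real (d n2) / real (d n1) - 1))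
            \<le> - 3 * ln (real n2)"
  obtains c where "c > 0" "\<And>m n. 1 \<le> m \<Longrightarrow> m < n \<Longrightarrow> c * (real n)\<^sup>2 \<le> a ^ (d n - d m)"
proof -
  have less: "d m < d n" if "1 \<le> m" "m < n" for m n
    using mono that by (auto simp: strict_mono_on_def)
  have le: "d m \<le> d n" if "1 \<le> m" "m \<le> n" for m n
    using less[of m n] that by (cases "m = n") auto
  have lna: "ln a > 0" using a by simp
  \<comment> \<open>Comes from y \<le> exp y at y = D * ln a / 4, raised to the fourth
    power.\<close>
  define K where "K = (4 / ln a) ^ 4"
  have K: "K > 0" unfolding K_def using lna by simp
  have pow4: "real D ^ 4 \<le> K * a ^ D" for D
  proof -
    define y where "y = real D * ln a / 4"
    have y: "y \<ge> 0" unfolding y_def using lna by simp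
    have "y \<le> exp y" using exp_ge_add_one_self[of y] by linarith
    then have "y ^ 4 \<le> exp y ^ 4"
      using y by (intro power_mono) auto
    also have "exp y ^ 4 = a ^ D"
      using a by (simp add: y_def exp_of_nat_mult[symmetric] exp_of_nat_mult)
    finally have "K * y ^ 4 \<le> K * a ^ D" using K by (intro mult_left_mono) auto
    moreover have "K * y ^ 4 = real D ^ 4"
      unfolding K_def y_def power_mult_distrib[symmetric] using lna by simp
    ultimately show ?thesis by simp
  qed
  obtain n0 where n0: "\<And>n1 n2. n1 \<ge> n0 \<Longrightarrow> n2 > n1 \<Longrightarrow>
            (2 * real (d n2) / real (d n1) - 1) * l
            + (real (d n1) - real (d n2)) * ln a
            - ln (real (d n2) * (real (d n2) / real (d n1) - 1))
            \<le> - 3 * ln (real n2)"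
    using growth unfolding eventually_sequentially by blast
  \<comment> \<open>The minimum with 1 gives c1^3 \<le> c1, hence c1^3 \<le> 1 / (4 * K), which is
    what the comparison of cubes below uses.\<close>
  define c1 where "c1 = min 1 (1 / (4 * K))"
  have c1: "0 < c1" "c1 \<le> 1" "c1 \<le> 1 / (4 * K)" unfolding c1_def using K by auto
  have step: "c1 * (real (Suc n))\<^sup>2 \<le> a ^ (d (Suc n) - d n)" if n: "n \<ge> n0" "n \<ge> 2" for n
  proof -
    let ?n = "real (Suc n)"
    define D where "D = d (Suc n) - d n"
    \<comment> \<open>The degree \<open>d 1\<close> may be 0, so the divisor \<open>d n\<close> is
      known to be positive only from n = 2 on.\<close>
    have d1: "1 \<le> d n" using less[of 1 n] n by simp
    have lt: "d n < d (Suc n)" using less[of n "Suc n"] n by simp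
    then have D: "real (d (Suc n)) = real (d n) + real D" "1 \<le> D" unfolding D_def by auto
    define w where "w = real (d (Suc n)) * (real (d (Suc n)) / real (d n) - 1)"
    have w: "w = real D * (1 + real D / real (d n))"
      unfolding w_def D(1) using d1 by (simp add: field_simps)
    have wpos: "0 < w" unfolding w using D d1 by (intro mult_pos_pos add_pos_nonneg) auto
    have "real D / real (d n) \<le> real D / 1" using d1 by (intro divide_left_mono) auto
    then have "w \<le> real D * (real D + real D)" unfolding w using D by (intro mult_left_mono) auto
    then have w_le: "w \<le> 2 * (real D)\<^sup>2" by (simp add: power2_eq_square)
    have "1 \<le> real (d (Suc n)) / real (d n)" using lt d1 by simp
    then have "0 \<le> (2 * real (d (Suc n)) / real (d n) - 1) * l" using l by (intro mult_nonneg_nonneg) auto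
    moreover have "(real (d n) - real (d (Suc n))) * ln a = - (real D * ln a)"
      unfolding D(1) by simp
    ultimately have "3 * ln ?n \<le> real D * ln a + ln w"
      using n0[of n "Suc n", folded w_def] n by linarith
    then have "ln (?n ^ 3) \<le> ln (a ^ D * w)"
      using a wpos by (simp add: ln_mult ln_realpow del: of_nat_Suc)
    then have "?n ^ 3 \<le> a ^ D * w"
      using a wpos by (subst (asm) ln_le_cancel_iff) auto
    also have "\<dots> \<le> a ^ D * (2 * (real D)\<^sup>2)" using w_le a by (intro mult_left_mono) auto
    \<comment> \<open>Squaring turns the factor 2 * D^2 into a multiple of D^4, which
      \<open>pow4\<close> trades for one more power of a^D. A sixth power of n then stands against a
      cube of a^D, and cube roots give n^2.\<close>
    finally have "(?n ^ 3)\<^sup>2 \<le> (a ^ D * (2 * (real D)\<^sup>2))\<^sup>2" by (intro power_mono) auto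
    also have "\<dots> = (a ^ D)\<^sup>2 * 4 * real D ^ 4" by (simp add: power_mult_distrib power_mult[symmetric])
    also have "\<dots> \<le> (a ^ D)\<^sup>2 * 4 * (K * a ^ D)" using pow4[of D] a by (intro mult_left_mono) auto
    also have "\<dots> = 4 * K * (a ^ D) ^ 3" by (simp add: power2_eq_square power3_eq_cube)
    also have "(?n ^ 3)\<^sup>2 = ?n ^ 6" by (simp add: power_mult[symmetric] del: of_nat_Suc)
    finally have n6: "?n ^ 6 \<le> 4 * K * (a ^ D) ^ 3" .
    have "(c1 * ?n\<^sup>2) ^ 3 = c1 ^ 3 * ?n ^ 6" by (simp add: power_mult_distrib power_mult[symmetric])
    also have "\<dots> \<le> (1 / (4 * K)) * ?n ^ 6"
    proof (rule mult_right_mono)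
      have "c1 ^ 3 \<le> c1 ^ 1" using c1 by (intro power_decreasing) auto
      then show "c1 ^ 3 \<le> 1 / (4 * K)" using c1 by simp
    qed simp
    also have "\<dots> \<le> (1 / (4 * K)) * (4 * K * (a ^ D) ^ 3)" using n6 K by (intro mult_left_mono) auto
    also have "\<dots> = (a ^ D) ^ 3" using K by simp
    finally show ?thesis unfolding D_def
      by (subst (asm) power_mono_iff) (use c1 a in auto)
  qed
  define n1 where "n1 = max n0 2 + 1"
  \<comment> \<open>The second entry makes c * n^2 \<le> 1 for the finitely many n below
    \<open>n1\<close>.\<close>
  define c where "c = min c1 (1 / (real n1)\<^sup>2)"
  show ?thesis
  proof
    show "c > 0" unfolding c_def n1_def using c1 by simp
    fix m n :: nat assume mn: "1 \<le> m" "m < n"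
    show "c * (real n)\<^sup>2 \<le> a ^ (d n - d m)"
    proof (cases "n \<ge> n1")
      case True
      then obtain k where k: "n = Suc k" "k \<ge> n0" "k \<ge> 2" unfolding n1_def by (cases n) auto
      have "c * (real n)\<^sup>2 \<le> c1 * (real n)\<^sup>2" unfolding c_def by (intro mult_right_mono) auto
      also have "\<dots> \<le> a ^ (d (Suc k) - d k)" using step[OF k(2,3)] k(1) by simp
      also have "\<dots> \<le> a ^ (d n - d m)" using a le[of m k] k mn by (intro power_increasing) auto
      finally show ?thesis .
    next
      case False
      have "c * (real n)\<^sup>2 \<le> 1 / (real n1)\<^sup>2 * (real n1)\<^sup>2"
        using False unfolding c_def by (intro mult_mono power_mono) auto
      also have "\<dots> \<le> 1" by simp
      also have "1 \<le> a ^ (d n - d m)" using a by simp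
      finally show ?thesis .
    qed
  qed
qed

section \<open>Convexity and decorrelation of polynomial differences\<close>

text \<open>Adding the tangent inequalities at two points shows that the first derivative is
  monotone near x, so its own derivative is nonnegative there.\<close>

lemma convex_on_poly_pderiv2_nonneg:
  fixes p :: "real poly"
  assumes cvx: "convex_on S (poly p)" and S: "open S" "x \<in> S"
  shows "0 \<le> poly (pderiv (pderiv p)) x"
proof -
  obtain e where e: "e > 0" "ball x e \<subseteq> S" using S open_contains_ball by blast
  have tangent: "poly p z - poly p y \<ge> poly (pderiv p) y * (z - y)" if "y \<in> ball x e" "z \<in> ball x e" for y z
  proof (rule convex_on_imp_above_tangent)
    show "convex_on (ball x e) (poly p)" using convex_on_subset[OF cvx e(2)] by simp
    show "(poly p has_real_derivative poly (pderiv p) y) (at y within ball x e)"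
      by (rule has_field_derivative_at_within[OF poly_DERIV])
  qed (use that in auto)
  have "mono_on (ball x e) (poly (pderiv p))"
  proof (rule mono_onI)
    fix y z assume yz: "y \<in> ball x e" "z \<in> ball x e" "y \<le> z"
    have "poly (pderiv p) y * (z - y) \<le> poly (pderiv p) z * (z - y)"
      using tangent[OF yz(1,2)] tangent[OF yz(2,1)] by (simp add: algebra_simps)
    then show "poly (pderiv p) y \<le> poly (pderiv p) z"
      using yz(3) by (cases "y = z") auto
  qed
  then show ?thesis
    by (rule mono_on_imp_deriv_nonneg[OF _ poly_DERIV]) (use e in auto)
qed

text \<open>By the gap hypothesis the slope of the faster difference exceeds the values of the
  slower one by a factor of order d n * n^2. The logarithm in the correlation estimate is O(d n), so
  it uses up the factor \<open>d n\<close> and leaves the decay 1 / n^2.\<close>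

lemma poly_differences_decorrelated:
  fixes f :: "nat \<Rightarrow> real poly" and d :: "nat \<Rightarrow> nat"
  assumes ab: "1 < a" "a < b"
    and mono: "strict_mono_on {1..} d"
    and incr: "\<And>m n. 1 \<le> m \<Longrightarrow> m < n \<Longrightarrow> strict_mono_on {1<..} (poly (f n - f m))"
    and cvx: "\<And>m n. 1 \<le> m \<Longrightarrow> m < n \<Longrightarrow> convex_on {1<..} (poly (f n - f m))"
    and c: "c > 0"
    and deriv: "\<And>\<alpha> m n. \<alpha> \<in> {a..b} \<Longrightarrow> 1 \<le> m \<Longrightarrow> m < n \<Longrightarrow>
          c * real (d n) * \<alpha> ^ d n \<le> poly (pderiv (f n - f m)) \<alpha>"
    and C: "C > 1"
    and val: "\<And>\<alpha> m n. \<alpha> \<in> {a..b} \<Longrightarrow> 1 \<le> m \<Longrightarrow> m < n \<Longrightarrow>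
          0 \<le> poly (f n - f m) \<alpha> \<and> poly (f n - f m) \<alpha> \<le> C * \<alpha> ^ d n"
    and c0: "c0 > 0"
    and gap: "\<And>m n. 1 \<le> m \<Longrightarrow> m < n \<Longrightarrow> c0 * (real n)\<^sup>2 \<le> a ^ (d n - d m)"
  shows "decorrelated_differences (lebesgue_on {a..b}) (\<lambda>n. poly (f n))
           (2 * C / (c * c0) * (3 + 2 * (ln (2 * C) + ln b)))"
proof -
  define M where "M = lebesgue_on {a..b}"
  define B where "B = 3 + 2 * (ln (2 * C) + ln b)"
  have b: "b > 1" using ab by simp
  have B: "B \<ge> 3" unfolding B_def using C b by simp
  have less: "d m < d n" if "1 \<le> m" "m < n" for m n
    using mono that by (auto simp: strict_mono_on_def)
  interpret M: finite_measure M
    unfolding M_def by (rule finite_measure_lebesgue_on) simp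
  have borel: "g \<in> borel_measurable M" if "g \<in> borel_measurable borel" for g :: "real \<Rightarrow> real"
    unfolding M_def using that by (intro measurable_restrict_space1 measurable_completion) simp
  have poly_meas [measurable]: "poly p \<in> borel_measurable borel" for p :: "real poly"
    by (intro borel_measurable_continuous_onI continuous_intros)
  have near_meas [measurable]: "(\<lambda>\<alpha>. near_int \<epsilon> (poly (f n) \<alpha> - poly (f m) \<alpha>)) \<in> borel_measurable borel" for \<epsilon> m n
    by measurable
  \<comment> \<open>Passes from the Lebesgue integral of the locale to the gauge integral of the
    analytic lemmas, for bounded Borel functions.\<close>
  have L_eq: "integral\<^sup>L M g = integral {a..b} g" if "g \<in> borel_measurable borel" "\<And>x. \<bar>g x\<bar> \<le> k" for g :: "real \<Rightarrow> real" and k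
  proof -
    have "integrable M g"
      using that(2) by (intro M.integrable_const_bound[of g k] borel[OF that(1)] AE_I2) simp
    then show ?thesis unfolding M_def by (rule lebesgue_integral_eq_integral) simp
  qed
  have cvx': "0 \<le> poly (pderiv (pderiv (f n - f m))) \<alpha>" if "\<alpha> \<in> {a..b}" "1 \<le> m" "m < n" for \<alpha> m n
    using cvx[OF that(2,3)] that ab by (intro convex_on_poly_pderiv2_nonneg[where S = "{1<..}"]) auto
  have "decorrelated_differences M (\<lambda>n. poly (f n)) (2 * C / (c * c0) * B)"
  proof (unfold_locales)
    show "poly (f n) \<in> borel_measurable M" for n by (rule borel[OF poly_meas])
  next
    fix \<epsilon> :: real and m n :: nat
    assume \<epsilon>: "0 < \<epsilon>" "\<epsilon> < 1/2" and mn: "1 \<le> m" "m < n"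
    have n: "0 < (real n)\<^sup>2" using mn by simp
    have dn: "1 \<le> real (d n)" using less[OF mn] by linarith
    have aab: "a \<in> {a..b}" using ab by simp
    have dpos: "0 < poly (pderiv (f n - f m)) \<alpha>" if "\<alpha> \<in> {a..b}" for \<alpha>
    proof -
      have "0 < c * real (d n) * \<alpha> ^ d n" using c dn that ab by simp
      then show ?thesis using deriv[OF that mn] by linarith
    qed
    have "(\<integral>\<omega>. near_int \<epsilon> (poly (f n) \<omega> - poly (f m) \<omega>) - 2 * \<epsilon> \<partial>M) =
        integral {a..b} (\<lambda>\<alpha>. near_int \<epsilon> (poly (f n - f m) \<alpha>) - 2 * \<epsilon>)"
    proof (subst L_eq[where k = 1])
      fix \<alpha>
      show "\<bar>near_int \<epsilon> (poly (f n) \<alpha> - poly (f m) \<alpha>) - 2 * \<epsilon>\<bar> \<le> 1"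
        using near_int_range[of \<epsilon> "poly (f n) \<alpha> - poly (f m) \<alpha>"] \<epsilon> by (auto simp: abs_le_iff)
    qed simp_all
    also have "\<bar>\<dots>\<bar> \<le> 2 * \<epsilon> / poly (pderiv (f n - f m)) a"
      using ab by (intro integral_near_int_bound(2)[OF \<epsilon> _ poly_DERIV poly_DERIV _ dpos cvx'] mn)
        (auto intro!: continuous_intros)
    also have "\<dots> \<le> 2 * \<epsilon> / (c * c0 * (real n)\<^sup>2)"
    proof (rule divide_left_mono)
      have "c0 * (real n)\<^sup>2 \<le> a ^ (d n - d m)" by (rule gap[OF mn])
      also have "\<dots> \<le> a ^ d n" using ab by (intro power_increasing) auto
      finally have "c * 1 * (c0 * (real n)\<^sup>2) \<le> c * real (d n) * a ^ d n"
        using c c0 dn ab by (intro mult_mono) auto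
      then show "c * c0 * (real n)\<^sup>2 \<le> poly (pderiv (f n - f m)) a"
        using deriv[OF aab mn] by simp
      show "0 < poly (pderiv (f n - f m)) a * (c * c0 * (real n)\<^sup>2)"
        using dpos[OF aab] c c0 n by simp
    qed (use \<epsilon> in auto)
    \<comment> \<open>Padding with C > 1 and B \<ge> 3 lets the mean bound share its constant with
      the correlation bound.\<close>
    also have "\<dots> = (2 / (c * c0) * 1) * \<epsilon> / (real n)\<^sup>2" by simp
    also have "\<dots> \<le> (2 * C / (c * c0) * B) * \<epsilon> / (real n)\<^sup>2"
      using C B c c0 \<epsilon> by (intro divide_right_mono mult_right_mono mult_mono divide_right_mono) auto
    finally show "\<bar>\<integral>\<omega>. near_int \<epsilon> (poly (f n) \<omega> - poly (f m) \<omega>) - 2 * \<epsilon> \<partial>M\<bar>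
        \<le> (2 * C / (c * c0) * B) * \<epsilon> / (real n)\<^sup>2" .
  next
    fix \<epsilon> \<delta> :: real and m n m' n' :: nat
    assume \<epsilon>: "0 < \<epsilon>" "\<epsilon> < 1/2" and \<delta>: "0 < \<delta>" "\<delta> < 1/2"
      and mn: "1 \<le> m" "m < n" and mn': "1 \<le> m'" "m' < n'" and nn: "n' < n"
    have n: "0 < (real n)\<^sup>2" using mn by simp
    have dn: "1 \<le> real (d n)" using less[OF mn] by linarith
    have dnn: "d n' < d n" using less[of n' n] mn' nn by simp
    \<comment> \<open>A lower bound for c * d n * \<alpha>^(d n) divided by C * \<alpha>^(d n'),
      obtained from the gap between d n' and d n. The denominator dominates both 1 and the slower
      difference.\<close>
    define L where "L = c * c0 * real (d n) * (real n)\<^sup>2 / C"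
    define H where "H = C * b ^ d n'"
    have L: "L > 0" unfolding L_def using c c0 dn n C by simp
    have H: "H \<ge> 1" unfolding H_def using C b mult_mono[of 1 C 1 "b ^ d n'"] by simp
    have g'_ge: "L * max 1 (poly (f n' - f m') \<alpha>) \<le> poly (pderiv (f n - f m)) \<alpha>" if \<alpha>: "\<alpha> \<in> {a..b}" for \<alpha>
    proof -
      have \<alpha>1: "1 \<le> \<alpha>" "a \<le> \<alpha>" using \<alpha> ab by auto
      have "1 \<le> C * \<alpha> ^ d n'" using C \<alpha>1 mult_mono[of 1 C 1 "\<alpha> ^ d n'"] by simp
      then have "max 1 (poly (f n' - f m') \<alpha>) \<le> C * \<alpha> ^ d n'" using val[OF \<alpha> mn'] by simp
      then have "L * max 1 (poly (f n' - f m') \<alpha>) \<le> L * (C * \<alpha> ^ d n')"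
        using L by (intro mult_left_mono) auto
      also have "\<dots> = c * real (d n) * (c0 * (real n)\<^sup>2 * \<alpha> ^ d n')"
        unfolding L_def using C by simp
      also have "\<dots> \<le> c * real (d n) * (\<alpha> ^ (d n - d n') * \<alpha> ^ d n')"
      proof (intro mult_left_mono mult_right_mono)
        have "c0 * (real n)\<^sup>2 \<le> a ^ (d n - d n')" using gap[of n' n] mn' nn by simp
        also have "\<dots> \<le> \<alpha> ^ (d n - d n')" using \<alpha>1 ab by (intro power_mono) auto
        finally show "c0 * (real n)\<^sup>2 \<le> \<alpha> ^ (d n - d n')" .
      qed (use c \<alpha>1 in auto)
      also have "\<dots> = c * real (d n) * \<alpha> ^ d n" using dnn by (simp add: power_add[symmetric])
      also have "\<dots> \<le> poly (pderiv (f n - f m)) \<alpha>" by (rule deriv[OF \<alpha> mn])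
      finally show ?thesis .
    qed
    have lnH: "3 + 2 * ln (H + 1) \<le> real (d n) * B"
    proof -
      have "ln (H + 1) \<le> ln (2 * H)" using H by (subst ln_le_cancel_iff) auto
      also have "\<dots> = ln (2 * C) + real (d n') * ln b"
        unfolding H_def using C b by (simp add: ln_mult ln_realpow)
      also have "\<dots> \<le> real (d n) * ln (2 * C) + real (d n) * ln b"
      proof (intro add_mono mult_right_mono)
        show "ln (2 * C) \<le> real (d n) * ln (2 * C)"
          using mult_right_mono[OF dn, of "ln (2 * C)"] C by simp
      qed (use dnn b in auto)
      finally show ?thesis unfolding B_def using dn by (simp add: algebra_simps)
    qed
    have "(\<integral>\<omega>. (near_int \<epsilon> (poly (f n) \<omega> - poly (f m) \<omega>) - 2 * \<epsilon>) * near_int \<delta> (poly (f n') \<omega> - poly (f m') \<omega>) \<partial>M) =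
        integral {a..b} (\<lambda>\<alpha>. (near_int \<epsilon> (poly (f n - f m) \<alpha>) - 2 * \<epsilon>) * near_int \<delta> (poly (f n' - f m') \<alpha>))"
    proof (subst L_eq[where k = 1])
      fix \<alpha>
      have "\<bar>near_int \<epsilon> (poly (f n) \<alpha> - poly (f m) \<alpha>) - 2 * \<epsilon>\<bar> \<le> 1"
        using near_int_range[of \<epsilon> "poly (f n) \<alpha> - poly (f m) \<alpha>"] \<epsilon> by (auto simp: abs_le_iff)
      then show "\<bar>(near_int \<epsilon> (poly (f n) \<alpha> - poly (f m) \<alpha>) - 2 * \<epsilon>) * near_int \<delta> (poly (f n') \<alpha> - poly (f m') \<alpha>)\<bar> \<le> 1"
        unfolding abs_mult using near_int_range[of \<delta> "poly (f n') \<alpha> - poly (f m') \<alpha>"] by (intro mult_le_one) auto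
    qed simp_all
    also have "\<bar>\<dots>\<bar> \<le> 2 * \<epsilon> / L * (3 + 2 * ln (H + 1))"
    proof (rule integral_near_int_correlation[OF \<epsilon> \<delta> poly_DERIV poly_DERIV])
      show "mono_on {a..b} (poly (f n' - f m'))"
      proof (rule mono_onI)
        fix y z assume "y \<in> {a..b}" "z \<in> {a..b}" "y \<le> z"
        then show "poly (f n' - f m') y \<le> poly (f n' - f m') z"
          using strict_mono_onD[OF incr[OF mn'], of y z] ab by (cases "y = z") auto
      qed
      fix \<alpha> assume \<alpha>: "\<alpha> \<in> {a..b}"
      have "C * \<alpha> ^ d n' \<le> H" unfolding H_def using \<alpha> ab C by (intro mult_left_mono power_mono) auto
      then show "0 \<le> poly (f n' - f m') \<alpha> \<and> poly (f n' - f m') \<alpha> \<le> H"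
        using val[OF \<alpha> mn'] by simp
    qed (use L H g'_ge cvx' mn in \<open>auto intro!: continuous_intros\<close>)
    also have "\<dots> \<le> 2 * \<epsilon> / L * (real (d n) * B)"
      using lnH \<epsilon> L by (intro mult_left_mono) auto
    also have "\<dots> = (2 * C / (c * c0) * B) * \<epsilon> / (real n)\<^sup>2"
      unfolding L_def using c c0 dn n C by (simp add: field_simps)
    finally show "\<bar>\<integral>\<omega>. (near_int \<epsilon> (poly (f n) \<omega> - poly (f m) \<omega>) - 2 * \<epsilon>) *
        near_int \<delta> (poly (f n') \<omega> - poly (f m') \<omega>) \<partial>M\<bar> \<le> (2 * C / (c * c0) * B) * \<epsilon> / (real n)\<^sup>2" .
  qed
  then show ?thesis unfolding M_def B_def .
qed

section \<open>Almost every \<alpha> > 1\<close>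

theorem theorem1p3:
  fixes f :: "nat \<Rightarrow> real poly"
    and d :: "nat \<Rightarrow> nat"
    and C :: "real \<Rightarrow> real \<Rightarrow> real"
  defines "d \<equiv> \<lambda>n. degree (f n)"
  assumes deg_increasing: "strict_mono_on {1..} d"
    and diff_increasing: "\<And>n1 n2. 1 \<le> n1 \<Longrightarrow> n1 < n2 \<Longrightarrow>
          strict_mono_on {1<..} (poly (f n2 - f n1))"
    and diff_convex: "\<And>n1 n2. 1 \<le> n1 \<Longrightarrow> n1 < n2 \<Longrightarrow>
          convex_on {1<..} (poly (f n2 - f n1))"
    and deriv_bound: "\<And>a b. 1 < a \<Longrightarrow> a < b \<Longrightarrow>
          \<exists>c>0. \<forall>\<alpha>\<in>{a..b}. \<forall>n1\<ge>1. \<forall>n2>n1.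
            deriv (poly (f n2 - f n1)) \<alpha> \<ge> c * real (d n2) * \<alpha> ^ d n2"
    and C_gt_1: "\<And>a b. 1 < a \<Longrightarrow> a < b \<Longrightarrow> C a b > 1"
    and value_bounds: "\<And>a b. 1 < a \<Longrightarrow> a < b \<Longrightarrow>
          \<forall>\<alpha>\<in>{a..b}. \<forall>n1\<ge>1. \<forall>n2>n1.
            \<alpha> ^ d n2 / C a b \<le> poly (f n2 - f n1) \<alpha> \<and>
            poly (f n2 - f n1) \<alpha> \<le> C a b * \<alpha> ^ d n2"
    and growth: "\<And>a b. 1 < a \<Longrightarrow> a < b \<Longrightarrow>
          \<forall>\<^sub>F n1 in sequentially. \<forall>n2>n1.
            (2 * real (d n2) / real (d n1) - 1) * ln (C a b)
            + (real (d n1) - real (d n2)) * ln a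
            - ln (real (d n2) * (real (d n2) / real (d n1) - 1))
            \<le> - 3 * ln (real n2)"
  shows "AE \<alpha> in lebesgue. \<alpha> > 1 \<longrightarrow>
           poissonian_pair_correlations (\<lambda>n. poly (f n) \<alpha>)"
proof -
  have deriv_poly: "deriv (poly p) \<alpha> = poly (pderiv p) \<alpha>" for p :: "real poly" and \<alpha>
    by (rule DERIV_imp_deriv[OF poly_DERIV])
  have local: "AE \<alpha> in lebesgue. \<alpha> \<in> {a..b} \<longrightarrow> poissonian_pair_correlations (\<lambda>n. poly (f n) \<alpha>)"
    if ab: "1 < a" "a < b" for a b
  proof -
    obtain c where c: "c > 0" and deriv: "\<And>\<alpha> n1 n2. \<alpha> \<in> {a..b} \<Longrightarrow> 1 \<le> n1 \<Longrightarrow> n1 < n2 \<Longrightarrow>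
        c * real (d n2) * \<alpha> ^ d n2 \<le> poly (pderiv (f n2 - f n1)) \<alpha>"
      using deriv_bound[OF ab] unfolding deriv_poly by blast
    have "0 \<le> ln (C a b)" using C_gt_1[OF ab] by simp
    from power_gap_lower_bound[OF deg_increasing ab(1) this growth[OF ab]]
    obtain c0 where c0: "c0 > 0" "\<And>m n. 1 \<le> m \<Longrightarrow> m < n \<Longrightarrow> c0 * (real n)\<^sup>2 \<le> a ^ (d n - d m)"
      by blast
    have val: "0 \<le> poly (f n - f m) \<alpha> \<and> poly (f n - f m) \<alpha> \<le> C a b * \<alpha> ^ d n"
      if "\<alpha> \<in> {a..b}" "1 \<le> m" "m < n" for \<alpha> m n
    proof -
      have "0 \<le> \<alpha> ^ d n / C a b" using that ab C_gt_1[OF ab] by simp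
      then show ?thesis using value_bounds[OF ab] that by (meson order_trans)
    qed
    interpret decorrelated_differences "lebesgue_on {a..b}" "\<lambda>n. poly (f n)"
      "2 * C a b / (c * c0) * (3 + 2 * (ln (2 * C a b) + ln b))"
      by (rule poly_differences_decorrelated[OF ab deg_increasing diff_increasing diff_convex c deriv
            C_gt_1[OF ab] val c0])
    show ?thesis
      using AE_poissonian_pair_correlations by (simp add: AE_restrict_space_iff)
  qed
  \<comment> \<open>Countably many compact intervals exhaust the half-line above 1; the shift by 2
    makes each of them nondegenerate, already for k = 0.\<close>
  have "AE \<alpha> in lebesgue. \<forall>k::nat. \<alpha> \<in> {1 + 1 / real (k + 2)..real (k + 2)} \<longrightarrow>
      poissonian_pair_correlations (\<lambda>n. poly (f n) \<alpha>)"
    unfolding AE_all_countable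
  proof
    fix k :: nat
    have "1 / real (k + 2) \<le> 1 / 2" by (intro divide_left_mono) auto
    moreover have "2 \<le> real (k + 2)" by simp
    ultimately have "1 + 1 / real (k + 2) < real (k + 2)" by linarith
    then show "AE \<alpha> in lebesgue. \<alpha> \<in> {1 + 1 / real (k + 2)..real (k + 2)} \<longrightarrow>
      poissonian_pair_correlations (\<lambda>n. poly (f n) \<alpha>)"
      by (intro local) auto
  qed
  then show ?thesis
  proof eventually_elim
    case (elim \<alpha>)
    show ?case
    proof
      assume "\<alpha> > 1"
      \<comment> \<open>One k serves both ends: k \<ge> \<alpha> for the right endpoint, k \<ge> 1 /
        (\<alpha> - 1) for the left one.\<close>
      obtain k :: nat where k: "max \<alpha> (1 / (\<alpha> - 1)) \<le> real k" using real_arch_simple by blast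
      have "1 / (\<alpha> - 1) \<le> real (k + 2)" using k by simp
      then have "1 / real (k + 2) \<le> \<alpha> - 1" using \<open>\<alpha> > 1\<close> by (simp add: field_simps)
      then show "poissonian_pair_correlations (\<lambda>n. poly (f n) \<alpha>)"
        using elim k by (auto dest!: spec[of _ k])
    qed
  qed
qed

end
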